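(* Let $p:\mathbb E\to\mathbb B$ be a fibration, $\mathcal T=(T,\eta,\mu)$ a monad on $\mathbb B$, and $R:\mathbb A\to\mathbb B_{\mathcal T}$, $S:\mathbb A\to\mathbb E$ a lifting parameter for $\mathcal T$ such that $(p,S)$ satisfies the codensity condition. Then the codensity lifting $\mathcal T^{\top\top}=(T^{\top\top},\eta^{\top\top},\mu^{\top\top})$ (constructed as in the context) is a monad on $\mathbb E$ and is a lifting of $\mathcal T$ along $p$.
   Context: Notation: juxtaposition denotes whiskering of functors and natural transformations, $\bullet$ vertical composition. Let $J\dashv K$, $J:\mathbb B\to\mathbb B_{\mathcal T}$, $K:\mathbb B_{\mathcal T}\to\mathbb B$ be the Kleisli resolution of $\mathcal T$ with counit $\epsilon:JK\to\mathrm{Id}$ (so $KJ=T$). A lifting of $\mathcal T$ along $p$ is a monad $(\dot T,\dot\eta,\dot\mu)$ on $\mathbb E$ with $p\dot T=Tp$, $p\dot\eta=\eta p$, $p\dot\mu=\mu p$ (no fibredness is required). A lifting parameter is a span of functors $R:\mathbb A\to\mathbb B_{\mathcal T}$, $S:\mathbb A\to\mathbb E$ with $KR=pS$. $(p,S)$ satisfies the codensity condition if a right Kan extension $(\mathrm{Ran}_SS,c:(\mathrm{Ran}_SS)S\to S)$ exists and $p$ preserves it. Then $\mathrm{Ran}_SS$ is the codensity monad with unit $u:\mathrm{Id}\to\mathrm{Ran}_SS$ and multiplication $m$ the unique natural transformations with $c\bullet uS=\mathrm{id}_S$ and $c\bullet mS=c\bullet(\mathrm{Ran}_SS)c$. Since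 $p$ preserves the Kan extension, for each $H:\mathbb E\to\mathbb B$ the map $\beta\mapsto pc\bullet\beta S$ is a bijection from natural transformations $H\to p\,\mathrm{Ran}_SS$ to natural transformations $HS\to pS$; write $\overline{(-)}$ for its inverse. Codensity lifting: regard $K\epsilon R$ as a natural transformation $TpS=KJKR\to KR=pS$, giving $\overline{K\epsilon R}:Tp\to p\,\mathrm{Ran}_SS$. Let $\sigma:T^{\top\top}\to\mathrm{Ran}_SS$ be a cartesian lifting of $\overline{K\epsilon R}$ with respect to the fibration $[\mathbb E,p]:[\mathbb E,\mathbb E]\to[\mathbb E,\mathbb B]$ (postcomposition with $p$), so $pT^{\top\top}=Tp$. Let $\eta^{\top\top}:\mathrm{Id}\to T^{\top\top}$ be the unique natural transformation above $\eta p$ with $\sigma\bullet\eta^{\top\top}=u$, and $\mu^{\top\top}:T^{\top\top}T^{\top\top}\to T^{\top\top}$ the unique natural transformation above $\mu p$ with $\sigma\bullet\mu^{\top\top}=m\bullet\sigma(\mathrm{Ran}_SS)\bullet T^{\top\top}\sigma$ (these exist by cartesianness of $\sigma$). *)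

theory Defs
  imports "HOL-Library.FuncSet"
begin

section \<open>Categories\<close>

record ('o, 'a) category =
  Obj :: "'o set"
  Arr :: "'a set"
  Dom :: "'a \<Rightarrow> 'o"
  Cod :: "'a \<Rightarrow> 'o"
  Ident :: "'o \<Rightarrow> 'a"
  Comp :: "'a \<Rightarrow> 'a \<Rightarrow> 'a" (infixr \<open>\<cdot>\<index>\<close> 70)

definition hom :: "('o, 'a) category \<Rightarrow> 'o \<Rightarrow> 'o \<Rightarrow> 'a set" where
  "hom C x y = {f \<in> Arr C. Dom C f = x \<and> Cod C f = y}"

locale category =
  fixes C :: "('o, 'a) category" (structure)
  assumes Dom_in: "f \<in> Arr C \<Longrightarrow> Dom C f \<in> Obj C"
    and Cod_in: "f \<in> Arr C \<Longrightarrow> Cod C f \<in> Obj C"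
    and Ident_in: "x \<in> Obj C \<Longrightarrow> Ident C x \<in> hom C x x"
    and Comp_in: "\<lbrakk>f \<in> hom C x y; g \<in> hom C y z\<rbrakk> \<Longrightarrow> g \<cdot> f \<in> hom C x z"
    and Comp_Ident: "f \<in> hom C x y \<Longrightarrow> f \<cdot> Ident C x = f"
    and Ident_Comp: "f \<in> hom C x y \<Longrightarrow> Ident C y \<cdot> f = f"
    and Comp_assoc: "\<lbrakk>f \<in> hom C w x; g \<in> hom C x y; h \<in> hom C y z\<rbrakk>
      \<Longrightarrow> (h \<cdot> g) \<cdot> f = h \<cdot> (g \<cdot> f)"


section \<open>Functors\<close>

text \<open>Functors carry their source and target category, and their two maps are
  \<open>undefined\<close> outside the source category. Hence equality of functors in the sense of
  category theory is equality in HOL. The same convention is used for natural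
  transformations.\<close>

record ('o1, 'a1, 'o2, 'a2) functr =
  FSrc :: "('o1, 'a1) category"
  FTgt :: "('o2, 'a2) category"
  FOb :: "'o1 \<Rightarrow> 'o2"
  FAr :: "'a1 \<Rightarrow> 'a2"

locale is_functor =
  fixes C :: "('o1, 'a1) category" and D :: "('o2, 'a2) category"
    and F :: "('o1, 'a1, 'o2, 'a2) functr"
  assumes source: "category C" and target: "category D"
    and FSrc_eq: "FSrc F = C" and FTgt_eq: "FTgt F = D"
    and FOb_ext: "FOb F \<in> extensional (Obj C)"
    and FAr_ext: "FAr F \<in> extensional (Arr C)"
    and FOb_in: "x \<in> Obj C \<Longrightarrow> FOb F x \<in> Obj D"
    and FAr_in: "f \<in> hom C x y \<Longrightarrow> FAr F f \<in> hom D (FOb F x) (FOb F y)"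
    and FAr_Ident: "x \<in> Obj C \<Longrightarrow> FAr F (Ident C x) = Ident D (FOb F x)"
    and FAr_Comp: "\<lbrakk>f \<in> hom C x y; g \<in> hom C y z\<rbrakk>
      \<Longrightarrow> FAr F (g \<cdot>\<^bsub>C\<^esub> f) = FAr F g \<cdot>\<^bsub>D\<^esub> FAr F f"

definition Id_functor :: "('o, 'a) category \<Rightarrow> ('o, 'a, 'o, 'a) functr" where
  "Id_functor C =
    \<lparr>FSrc = C, FTgt = C, FOb = (\<lambda>x\<in>Obj C. x), FAr = (\<lambda>f\<in>Arr C. f)\<rparr>"

definition fcomp :: "('o2, 'a2, 'o3, 'a3) functr \<Rightarrow> ('o1, 'a1, 'o2, 'a2) functr
    \<Rightarrow> ('o1, 'a1, 'o3, 'a3) functr" (infixr \<open>\<odot>\<close> 75) where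
  "G \<odot> F =
    \<lparr>FSrc = FSrc F, FTgt = FTgt G,
     FOb = (\<lambda>x\<in>Obj (FSrc F). FOb G (FOb F x)),
     FAr = (\<lambda>f\<in>Arr (FSrc F). FAr G (FAr F f))\<rparr>"


section \<open>Natural transformations\<close>

record ('o1, 'a1, 'o2, 'a2) nattrans =
  NSrc :: "('o1, 'a1, 'o2, 'a2) functr"
  NTgt :: "('o1, 'a1, 'o2, 'a2) functr"
  NMap :: "'o1 \<Rightarrow> 'a2"

locale nat_trans =
  fixes C :: "('o1, 'a1) category" and D :: "('o2, 'a2) category"
    and F G :: "('o1, 'a1, 'o2, 'a2) functr"
    and \<alpha> :: "('o1, 'a1, 'o2, 'a2) nattrans"
  assumes source: "is_functor C D F" and target: "is_functor C D G"
    and NSrc_eq: "NSrc \<alpha> = F" and NTgt_eq: "NTgt \<alpha> = G"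
    and NMap_ext: "NMap \<alpha> \<in> extensional (Obj C)"
    and NMap_in: "x \<in> Obj C \<Longrightarrow> NMap \<alpha> x \<in> hom D (FOb F x) (FOb G x)"
    and naturality: "f \<in> hom C x y
      \<Longrightarrow> NMap \<alpha> y \<cdot>\<^bsub>D\<^esub> FAr F f = FAr G f \<cdot>\<^bsub>D\<^esub> NMap \<alpha> x"

definition Id_nat :: "('o1, 'a1, 'o2, 'a2) functr \<Rightarrow> ('o1, 'a1, 'o2, 'a2) nattrans" where
  "Id_nat F =
    \<lparr>NSrc = F, NTgt = F, NMap = (\<lambda>x\<in>Obj (FSrc F). Ident (FTgt F) (FOb F x))\<rparr>"

definition vcomp :: "('o1, 'a1, 'o2, 'a2) nattrans \<Rightarrow> ('o1, 'a1, 'o2, 'a2) nattrans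
    \<Rightarrow> ('o1, 'a1, 'o2, 'a2) nattrans" (infixr \<open>\<bullet>\<close> 65) where
  "\<beta> \<bullet> \<alpha> =
    \<lparr>NSrc = NSrc \<alpha>, NTgt = NTgt \<beta>,
     NMap = (\<lambda>x\<in>Obj (FSrc (NSrc \<alpha>)). NMap \<beta> x \<cdot>\<^bsub>FTgt (NSrc \<alpha>)\<^esub> NMap \<alpha> x)\<rparr>"

text \<open>The whiskerings \<open>G\<alpha>\<close> and \<open>\<alpha>F\<close> are written \<open>G \<rhd> \<alpha>\<close> and \<open>\<alpha> \<lhd> F\<close>.\<close>

definition whisker_left :: "('o2, 'a2, 'o3, 'a3) functr \<Rightarrow> ('o1, 'a1, 'o2, 'a2) nattrans
    \<Rightarrow> ('o1, 'a1, 'o3, 'a3) nattrans" (infixr \<open>\<rhd>\<close> 75) where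
  "G \<rhd> \<alpha> =
    \<lparr>NSrc = G \<odot> NSrc \<alpha>, NTgt = G \<odot> NTgt \<alpha>,
     NMap = (\<lambda>x\<in>Obj (FSrc (NSrc \<alpha>)). FAr G (NMap \<alpha> x))\<rparr>"

definition whisker_right :: "('o2, 'a2, 'o3, 'a3) nattrans \<Rightarrow> ('o1, 'a1, 'o2, 'a2) functr
    \<Rightarrow> ('o1, 'a1, 'o3, 'a3) nattrans" (infixl \<open>\<lhd>\<close> 76) where
  "\<alpha> \<lhd> F =
    \<lparr>NSrc = NSrc \<alpha> \<odot> F, NTgt = NTgt \<alpha> \<odot> F,
     NMap = (\<lambda>x\<in>Obj (FSrc F). NMap \<alpha> (FOb F x))\<rparr>"


section \<open>Functor categories\<close>

definition functor_category :: "('o1, 'a1) category \<Rightarrow> ('o2, 'a2) category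
    \<Rightarrow> (('o1, 'a1, 'o2, 'a2) functr, ('o1, 'a1, 'o2, 'a2) nattrans) category" where
  "functor_category C D =
    \<lparr>Obj = {F. is_functor C D F},
     Arr = {\<alpha>. \<exists>F G. nat_trans C D F G \<alpha>},
     Dom = NSrc, Cod = NTgt, Ident = Id_nat, Comp = vcomp\<rparr>"

text \<open>\<open>[X, p] : [X, E] \<rightarrow> [X, B]\<close>, for \<open>p : E \<rightarrow> B\<close>.\<close>

definition postcomposition :: "('o1, 'a1) category \<Rightarrow> ('o2, 'a2, 'o3, 'a3) functr
    \<Rightarrow> (('o1, 'a1, 'o2, 'a2) functr, ('o1, 'a1, 'o2, 'a2) nattrans,
        ('o1, 'a1, 'o3, 'a3) functr, ('o1, 'a1, 'o3, 'a3) nattrans) functr" where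
  "postcomposition X p =
    \<lparr>FSrc = functor_category X (FSrc p), FTgt = functor_category X (FTgt p),
     FOb = (\<lambda>F\<in>Obj (functor_category X (FSrc p)). p \<odot> F),
     FAr = (\<lambda>\<alpha>\<in>Arr (functor_category X (FSrc p)). p \<rhd> \<alpha>)\<rparr>"


section \<open>Fibrations\<close>

definition cartesian_arrow :: "('oe, 'ae, 'ob, 'ab) functr \<Rightarrow> 'ae \<Rightarrow> bool" where
  "cartesian_arrow p f \<longleftrightarrow> f \<in> Arr (FSrc p) \<and>
    (\<forall>g \<in> Arr (FSrc p). \<forall>w \<in> hom (FTgt p) (FOb p (Dom (FSrc p) g)) (FOb p (Dom (FSrc p) f)).
      Cod (FSrc p) g = Cod (FSrc p) f \<and> FAr p f \<cdot>\<^bsub>FTgt p\<^esub> w = FAr p g \<longrightarrow>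
      (\<exists>!h. h \<in> hom (FSrc p) (Dom (FSrc p) g) (Dom (FSrc p) f) \<and>
            FAr p h = w \<and> f \<cdot>\<^bsub>FSrc p\<^esub> h = g))"

text \<open>\<open>f\<close> is a cartesian lifting of \<open>v : b \<rightarrow> p y\<close> with codomain \<open>y\<close>.\<close>

definition cartesian_lifting :: "('oe, 'ae, 'ob, 'ab) functr \<Rightarrow> 'ab \<Rightarrow> 'oe \<Rightarrow> 'ae \<Rightarrow> bool" where
  "cartesian_lifting p v y f \<longleftrightarrow>
    cartesian_arrow p f \<and> Cod (FSrc p) f = y \<and> FAr p f = v"

definition fibration :: "('oe, 'ae) category \<Rightarrow> ('ob, 'ab) category
    \<Rightarrow> ('oe, 'ae, 'ob, 'ab) functr \<Rightarrow> bool" where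
  "fibration E B p \<longleftrightarrow> is_functor E B p \<and>
    (\<forall>y \<in> Obj E. \<forall>v \<in> Arr B. Cod B v = FOb p y \<longrightarrow> (\<exists>f. cartesian_lifting p v y f))"


section \<open>Monads and liftings\<close>

record ('o, 'a) monad =
  MFun :: "('o, 'a, 'o, 'a) functr"
  MUnit :: "('o, 'a, 'o, 'a) nattrans"
  MMult :: "('o, 'a, 'o, 'a) nattrans"

locale is_monad =
  fixes C :: "('o, 'a) category" and \<T> :: "('o, 'a) monad"
  assumes functor_MFun: "is_functor C C (MFun \<T>)"
    and nat_MUnit: "nat_trans C C (Id_functor C) (MFun \<T>) (MUnit \<T>)"
    and nat_MMult: "nat_trans C C (MFun \<T> \<odot> MFun \<T>) (MFun \<T>) (MMult \<T>)"
    and left_unit: "MMult \<T> \<bullet> MUnit \<T> \<lhd> MFun \<T> = Id_nat (MFun \<T>)"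
    and right_unit: "MMult \<T> \<bullet> MFun \<T> \<rhd> MUnit \<T> = Id_nat (MFun \<T>)"
    and assoc: "MMult \<T> \<bullet> MMult \<T> \<lhd> MFun \<T> = MMult \<T> \<bullet> MFun \<T> \<rhd> MMult \<T>"

definition is_lifting :: "('oe, 'ae) category \<Rightarrow> ('oe, 'ae, 'ob, 'ab) functr
    \<Rightarrow> ('ob, 'ab) monad \<Rightarrow> ('oe, 'ae) monad \<Rightarrow> bool" where
  "is_lifting E p \<T> \<T>' \<longleftrightarrow> is_monad E \<T>' \<and>
    p \<odot> MFun \<T>' = MFun \<T> \<odot> p \<and>
    p \<rhd> MUnit \<T>' = MUnit \<T> \<lhd> p \<and>
    p \<rhd> MMult \<T>' = MMult \<T> \<lhd> p"


section \<open>The Kleisli resolution\<close>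

text \<open>A Kleisli arrow \<open>x \<rightarrow> y\<close> is an arrow \<open>f : x \<rightarrow> T y\<close>. It is represented as \<open>(f, y)\<close>,
  because \<open>y\<close> need not be determined by \<open>T y\<close>.\<close>

definition kleisli :: "('o, 'a) category \<Rightarrow> ('o, 'a) monad \<Rightarrow> ('o, 'a \<times> 'o) category" where
  "kleisli B \<T> =
    \<lparr>Obj = Obj B,
     Arr = {(f, y). y \<in> Obj B \<and> f \<in> Arr B \<and> Cod B f = FOb (MFun \<T>) y},
     Dom = (\<lambda>(f, y). Dom B f),
     Cod = snd,
     Ident = (\<lambda>x. (NMap (MUnit \<T>) x, x)),
     Comp = (\<lambda>(g, z) (f, y). (NMap (MMult \<T>) z \<cdot>\<^bsub>B\<^esub> FAr (MFun \<T>) g \<cdot>\<^bsub>B\<^esub> f, z))\<rparr>"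

definition kleisli_J :: "('o, 'a) category \<Rightarrow> ('o, 'a) monad
    \<Rightarrow> ('o, 'a, 'o, 'a \<times> 'o) functr" where
  "kleisli_J B \<T> =
    \<lparr>FSrc = B, FTgt = kleisli B \<T>,
     FOb = (\<lambda>x\<in>Obj B. x),
     FAr = (\<lambda>f\<in>Arr B. (NMap (MUnit \<T>) (Cod B f) \<cdot>\<^bsub>B\<^esub> f, Cod B f))\<rparr>"

definition kleisli_K :: "('o, 'a) category \<Rightarrow> ('o, 'a) monad
    \<Rightarrow> ('o, 'a \<times> 'o, 'o, 'a) functr" where
  "kleisli_K B \<T> =
    \<lparr>FSrc = kleisli B \<T>, FTgt = B,
     FOb = (\<lambda>x\<in>Obj B. FOb (MFun \<T>) x),
     FAr = (\<lambda>(f, y)\<in>Arr (kleisli B \<T>). NMap (MMult \<T>) y \<cdot>\<^bsub>B\<^esub> FAr (MFun \<T>) f)\<rparr>"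

definition kleisli_counit :: "('o, 'a) category \<Rightarrow> ('o, 'a) monad
    \<Rightarrow> ('o, 'a \<times> 'o, 'o, 'a \<times> 'o) nattrans" where
  "kleisli_counit B \<T> =
    \<lparr>NSrc = kleisli_J B \<T> \<odot> kleisli_K B \<T>,
     NTgt = Id_functor (kleisli B \<T>),
     NMap = (\<lambda>y\<in>Obj B. (Ident B (FOb (MFun \<T>) y), y))\<rparr>"

definition lifting_parameter :: "('oa, 'aa) category \<Rightarrow> ('oe, 'ae) category
    \<Rightarrow> ('ob, 'ab) category \<Rightarrow> ('oe, 'ae, 'ob, 'ab) functr \<Rightarrow> ('ob, 'ab) monad
    \<Rightarrow> ('oa, 'aa, 'ob, 'ab \<times> 'ob) functr \<Rightarrow> ('oa, 'aa, 'oe, 'ae) functr \<Rightarrow> bool" where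
  "lifting_parameter A E B p \<T> R S \<longleftrightarrow>
    is_functor A (kleisli B \<T>) R \<and> is_functor A E S \<and> kleisli_K B \<T> \<odot> R = p \<odot> S"


section \<open>Right Kan extensions\<close>

text \<open>\<open>(L, c)\<close> is a right Kan extension of \<open>F : A \<rightarrow> D\<close> along \<open>S : A \<rightarrow> C\<close>, where
  \<open>L : C \<rightarrow> D\<close> and \<open>c : L S \<rightarrow> F\<close>.\<close>

definition right_kan_extension :: "('oa, 'aa) category \<Rightarrow> ('oc, 'ac) category
    \<Rightarrow> ('od, 'ad) category \<Rightarrow> ('oa, 'aa, 'oc, 'ac) functr \<Rightarrow> ('oa, 'aa, 'od, 'ad) functr
    \<Rightarrow> ('oc, 'ac, 'od, 'ad) functr \<Rightarrow> ('oa, 'aa, 'od, 'ad) nattrans \<Rightarrow> bool" where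
  "right_kan_extension A C D S F L c \<longleftrightarrow>
    is_functor A C S \<and> is_functor A D F \<and> is_functor C D L \<and> nat_trans A D (L \<odot> S) F c \<and>
    (\<forall>H \<gamma>. is_functor C D H \<and> nat_trans A D (H \<odot> S) F \<gamma> \<longrightarrow>
      (\<exists>!\<beta>. nat_trans C D H L \<beta> \<and> c \<bullet> \<beta> \<lhd> S = \<gamma>))"

definition preserves_right_kan_extension :: "('oa, 'aa) category \<Rightarrow> ('oc, 'ac) category
    \<Rightarrow> ('od', 'ad') category \<Rightarrow> ('od, 'ad, 'od', 'ad') functr
    \<Rightarrow> ('oa, 'aa, 'oc, 'ac) functr \<Rightarrow> ('oa, 'aa, 'od, 'ad) functr
    \<Rightarrow> ('oc, 'ac, 'od, 'ad) functr \<Rightarrow> ('oa, 'aa, 'od, 'ad) nattrans \<Rightarrow> bool" where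
  "preserves_right_kan_extension A C D' p S F L c \<longleftrightarrow>
    right_kan_extension A C D' S (p \<odot> F) (p \<odot> L) (p \<rhd> c)"

text \<open>For a right Kan extension \<open>(L, c)\<close> along \<open>S\<close>, the inverse of the bijection
  \<open>\<beta> \<mapsto> c \<bullet> \<beta>S\<close> from transformations \<open>H \<rightarrow> L\<close> to transformations \<open>H S \<rightarrow> F\<close>.\<close>

definition kan_transpose :: "('oc, 'ac) category \<Rightarrow> ('od, 'ad) category
    \<Rightarrow> ('oa, 'aa, 'oc, 'ac) functr \<Rightarrow> ('oc, 'ac, 'od, 'ad) functr
    \<Rightarrow> ('oa, 'aa, 'od, 'ad) nattrans \<Rightarrow> ('oc, 'ac, 'od, 'ad) functr
    \<Rightarrow> ('oa, 'aa, 'od, 'ad) nattrans \<Rightarrow> ('oc, 'ac, 'od, 'ad) nattrans" where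
  "kan_transpose C D S L c H \<gamma> = (THE \<beta>. nat_trans C D H L \<beta> \<and> c \<bullet> \<beta> \<lhd> S = \<gamma>)"


section \<open>The codensity monad and the codensity lifting\<close>

text \<open>In this section \<open>(G, c)\<close> is a right Kan extension of \<open>S : A \<rightarrow> E\<close> along itself.\<close>

definition codensity_unit :: "('oe, 'ae) category \<Rightarrow> ('oa, 'aa, 'oe, 'ae) functr
    \<Rightarrow> ('oe, 'ae, 'oe, 'ae) functr \<Rightarrow> ('oa, 'aa, 'oe, 'ae) nattrans
    \<Rightarrow> ('oe, 'ae, 'oe, 'ae) nattrans" where
  "codensity_unit E S G c = kan_transpose E E S G c (Id_functor E) (Id_nat S)"

definition codensity_mult :: "('oe, 'ae) category \<Rightarrow> ('oa, 'aa, 'oe, 'ae) functr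
    \<Rightarrow> ('oe, 'ae, 'oe, 'ae) functr \<Rightarrow> ('oa, 'aa, 'oe, 'ae) nattrans
    \<Rightarrow> ('oe, 'ae, 'oe, 'ae) nattrans" where
  "codensity_mult E S G c = kan_transpose E E S G c (G \<odot> G) (c \<bullet> G \<rhd> c)"

text \<open>The transpose \<open>T p \<rightarrow> p G\<close> of \<open>K\<epsilon>R : T p S \<rightarrow> p S\<close>.\<close>

definition codensity_comparison :: "('oe, 'ae) category \<Rightarrow> ('ob, 'ab) category
    \<Rightarrow> ('oe, 'ae, 'ob, 'ab) functr \<Rightarrow> ('ob, 'ab) monad
    \<Rightarrow> ('oa, 'aa, 'ob, 'ab \<times> 'ob) functr \<Rightarrow> ('oa, 'aa, 'oe, 'ae) functr
    \<Rightarrow> ('oe, 'ae, 'oe, 'ae) functr \<Rightarrow> ('oa, 'aa, 'oe, 'ae) nattrans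
    \<Rightarrow> ('oe, 'ae, 'ob, 'ab) nattrans" where
  "codensity_comparison E B p \<T> R S G c =
    kan_transpose E B S (p \<odot> G) (p \<rhd> c) (MFun \<T> \<odot> p)
      (kleisli_K B \<T> \<rhd> kleisli_counit B \<T> \<lhd> R)"

text \<open>The codensity lifting determined by a cartesian lifting
  \<open>\<sigma> : T\<^sup>\<top>\<^sup>\<top> \<rightarrow> G\<close> of the comparison.\<close>

definition codensity_lifting :: "('oe, 'ae) category \<Rightarrow> ('oe, 'ae, 'ob, 'ab) functr
    \<Rightarrow> ('ob, 'ab) monad \<Rightarrow> ('oa, 'aa, 'oe, 'ae) functr
    \<Rightarrow> ('oe, 'ae, 'oe, 'ae) functr \<Rightarrow> ('oa, 'aa, 'oe, 'ae) nattrans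
    \<Rightarrow> ('oe, 'ae, 'oe, 'ae) nattrans \<Rightarrow> ('oe, 'ae) monad" where
  "codensity_lifting E p \<T> S G c \<sigma> =
    (let T' = NSrc \<sigma> in
     \<lparr>MFun = T',
      MUnit = (THE \<eta>'. nat_trans E E (Id_functor E) T' \<eta>' \<and>
        p \<rhd> \<eta>' = MUnit \<T> \<lhd> p \<and> \<sigma> \<bullet> \<eta>' = codensity_unit E S G c),
      MMult = (THE \<mu>'. nat_trans E E (T' \<odot> T') T' \<mu>' \<and>
        p \<rhd> \<mu>' = MMult \<T> \<lhd> p \<and>
        \<sigma> \<bullet> \<mu>' = codensity_mult E S G c \<bullet> \<sigma> \<lhd> G \<bullet> T' \<rhd> \<sigma>)\<rparr>)"

end

theory Submission
  imports Defs
begin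

text \<open>Cartesian liftings in \<open>[E, p]\<close> exist because they can be chosen pointwise in the fibration.
  The transformation \<open>\<xi> = K\<epsilon>R\<close> satisfies the unit and multiplication laws of a
  \<open>T\<close>-algebra on \<open>p S\<close>. Transposing these laws along the Kan extension \<open>p c\<close> shows that
  \<open>\<alpha> : T p \<rightarrow> p G\<close>, the transpose of \<open>\<xi>\<close>, is compatible with \<open>\<eta>\<close>, \<open>\<mu>\<close> and with the unit \<open>u\<close>
  and multiplication \<open>m\<close> of the codensity monad \<open>G\<close>. This is exactly what is needed to factor
  \<open>u\<close> and \<open>m \<bullet> \<sigma>G \<bullet> T'\<sigma>\<close> through the cartesian \<open>\<sigma>\<close>. Two transformations into \<open>T'\<close> agree if
  their images under \<open>p\<close> and their composites with \<open>\<sigma>\<close> agree, so the monad laws of \<open>T'\<close>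
  follow from those of \<open>T\<close> and of \<open>G\<close>.\<close>

section \<open>Calculus of functors and natural transformations\<close>

context category
begin

lemma Dom_Obj [simp]: "f \<in> Arr C \<Longrightarrow> Dom C f \<in> Obj C"
  by (rule Dom_in)

lemma Cod_Obj [simp]: "f \<in> Arr C \<Longrightarrow> Cod C f \<in> Obj C"
  by (rule Cod_in)

lemma Ident_simps [simp]:
  assumes "x \<in> Obj C"
  shows "Ident C x \<in> Arr C" "Dom C (Ident C x) = x" "Cod C (Ident C x) = x"
  using Ident_in [OF assms] by (auto simp: hom_def)

lemma Comp_simps [simp]:
  assumes "f \<in> Arr C" "g \<in> Arr C" "Cod C f = Dom C g"
  shows "g \<cdot> f \<in> Arr C" "Dom C (g \<cdot> f) = Dom C f" "Cod C (g \<cdot> f) = Cod C g"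
  using Comp_in [of f "Dom C f" "Dom C g" g "Cod C g"] assms by (auto simp: hom_def)

lemma Comp_Ident_right [simp]: "\<lbrakk>f \<in> Arr C; Dom C f = x\<rbrakk> \<Longrightarrow> f \<cdot> Ident C x = f"
  using Comp_Ident [of f x "Cod C f"] by (simp add: hom_def)

lemma Comp_Ident_left [simp]: "\<lbrakk>f \<in> Arr C; Cod C f = y\<rbrakk> \<Longrightarrow> Ident C y \<cdot> f = f"
  using Ident_Comp [of f "Dom C f" y] by (simp add: hom_def)

lemma Comp_assoc_Arr [simp]:
  assumes "f \<in> Arr C" "g \<in> Arr C" "h \<in> Arr C" "Cod C f = Dom C g" "Cod C g = Dom C h"
  shows "(h \<cdot> g) \<cdot> f = h \<cdot> (g \<cdot> f)"
  using Comp_assoc [of f "Dom C f" "Dom C g" g "Dom C h" h "Cod C h"] assms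
  by (simp add: hom_def)

text \<open>Composites are normalized to the right by \<open>Comp_assoc_Arr\<close>, which hides the
  subterm \<open>h \<cdot> g\<close> when something precedes it. The pattern
  \<open>Comp_extend [OF eq]\<close> makes an equation \<open>eq\<close> usable as a rewrite rule in
  the middle of such a composite.\<close>

lemma Comp_extend:
  assumes "h \<cdot> g = k" "f \<in> Arr C" "g \<in> Arr C" "h \<in> Arr C" "Cod C f = Dom C g" "Cod C g = Dom C h"
  shows "h \<cdot> (g \<cdot> f) = k \<cdot> f"
  using Comp_assoc_Arr [OF assms(2-)] assms(1) by simp

end

context is_functor
begin

sublocale src: category C by (rule source)

sublocale tgt: category D by (rule target)

lemma FSrc_FTgt [simp]: "FSrc F = C" "FTgt F = D"
  by (rule FSrc_eq FTgt_eq)+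

lemma FOb_Obj [simp]: "x \<in> Obj C \<Longrightarrow> FOb F x \<in> Obj D"
  by (rule FOb_in)

lemma FAr_simps [simp]:
  assumes "f \<in> Arr C"
  shows "FAr F f \<in> Arr D" "Dom D (FAr F f) = FOb F (Dom C f)" "Cod D (FAr F f) = FOb F (Cod C f)"
  using FAr_in [of f "Dom C f" "Cod C f"] assms by (auto simp: hom_def)

lemma FAr_Ident_simp [simp]: "x \<in> Obj C \<Longrightarrow> FAr F (Ident C x) = Ident D (FOb F x)"
  by (rule FAr_Ident)

lemma FAr_Comp_Arr [simp]:
  "\<lbrakk>f \<in> Arr C; g \<in> Arr C; Cod C f = Dom C g\<rbrakk>
    \<Longrightarrow> FAr F (g \<cdot>\<^bsub>C\<^esub> f) = FAr F g \<cdot>\<^bsub>D\<^esub> FAr F f"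
  using FAr_Comp [of f "Dom C f" "Dom C g" g "Cod C g"] by (simp add: hom_def)

end

context nat_trans
begin

sublocale src: is_functor C D F by (rule source)

sublocale tgt: is_functor C D G by (rule target)

lemma NSrc_NTgt [simp]: "NSrc \<alpha> = F" "NTgt \<alpha> = G"
  by (rule NSrc_eq NTgt_eq)+

lemma NMap_simps [simp]:
  assumes "x \<in> Obj C"
  shows "NMap \<alpha> x \<in> Arr D" "Dom D (NMap \<alpha> x) = FOb F x" "Cod D (NMap \<alpha> x) = FOb G x"
  using NMap_in [OF assms] by (auto simp: hom_def)

lemma naturality_Arr:
  "\<lbrakk>f \<in> Arr C; Dom C f = x; Cod C f = y\<rbrakk>
    \<Longrightarrow> NMap \<alpha> y \<cdot>\<^bsub>D\<^esub> FAr F f = FAr G f \<cdot>\<^bsub>D\<^esub> NMap \<alpha> x"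
  using naturality [of f x y] by (simp add: hom_def)

end

section \<open>Introduction and extensionality rules for functors and transformations\<close>

lemma is_functorI:
  assumes "category C" "category D" "FSrc F = C" "FTgt F = D"
    and "FOb F \<in> extensional (Obj C)" "FAr F \<in> extensional (Arr C)"
    and "\<And>x. x \<in> Obj C \<Longrightarrow> FOb F x \<in> Obj D"
    and "\<And>f. f \<in> Arr C \<Longrightarrow> FAr F f \<in> hom D (FOb F (Dom C f)) (FOb F (Cod C f))"
    and "\<And>x. x \<in> Obj C \<Longrightarrow> FAr F (Ident C x) = Ident D (FOb F x)"
    and "\<And>f g. \<lbrakk>f \<in> Arr C; g \<in> Arr C; Cod C f = Dom C g\<rbrakk>
      \<Longrightarrow> FAr F (g \<cdot>\<^bsub>C\<^esub> f) = FAr F g \<cdot>\<^bsub>D\<^esub> FAr F f"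
  shows "is_functor C D F"
  using assms by unfold_locales (auto simp: hom_def category_def)

lemma nat_transI:
  assumes "is_functor C D F" "is_functor C D G" "NSrc \<alpha> = F" "NTgt \<alpha> = G"
    and "NMap \<alpha> \<in> extensional (Obj C)"
    and "\<And>x. x \<in> Obj C \<Longrightarrow> NMap \<alpha> x \<in> hom D (FOb F x) (FOb G x)"
    and "\<And>f. f \<in> Arr C \<Longrightarrow>
      NMap \<alpha> (Cod C f) \<cdot>\<^bsub>D\<^esub> FAr F f = FAr G f \<cdot>\<^bsub>D\<^esub> NMap \<alpha> (Dom C f)"
  shows "nat_trans C D F G \<alpha>"
  using assms by (auto simp: nat_trans_def hom_def)

text \<open>Extensionality fixes both maps off \<open>C\<close>, and the remaining fields are
  \<open>C\<close> and \<open>D\<close>, so agreement on \<open>C\<close> is already equality of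
  records.\<close>

lemma functor_eqI:
  assumes "is_functor C D F" "is_functor C D G"
    and "\<And>x. x \<in> Obj C \<Longrightarrow> FOb F x = FOb G x" "\<And>f. f \<in> Arr C \<Longrightarrow> FAr F f = FAr G f"
  shows "F = G"
proof -
  interpret F: is_functor C D F by fact
  interpret G: is_functor C D G by fact
  have "FOb F = FOb G"
    by (rule extensionalityI [OF F.FOb_ext G.FOb_ext assms(3)])
  moreover have "FAr F = FAr G"
    by (rule extensionalityI [OF F.FAr_ext G.FAr_ext assms(4)])
  ultimately show ?thesis by (intro functr.equality) auto
qed

lemma nat_trans_eqI:
  assumes "nat_trans C D F G \<alpha>" "nat_trans C D F G \<beta>"
    and "\<And>x. x \<in> Obj C \<Longrightarrow> NMap \<alpha> x = NMap \<beta> x"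
  shows "\<alpha> = \<beta>"
proof -
  interpret \<alpha>: nat_trans C D F G \<alpha> by fact
  interpret \<beta>: nat_trans C D F G \<beta> by fact
  have "NMap \<alpha> = NMap \<beta>"
    by (rule extensionalityI [OF \<alpha>.NMap_ext \<beta>.NMap_ext assms(3)])
  then show ?thesis by (intro nattrans.equality) auto
qed

lemma Id_functor_simps [simp]:
  "FSrc (Id_functor C) = C" "FTgt (Id_functor C) = C"
  "x \<in> Obj C \<Longrightarrow> FOb (Id_functor C) x = x" "f \<in> Arr C \<Longrightarrow> FAr (Id_functor C) f = f"
  by (simp_all add: Id_functor_def)

lemma fcomp_simps [simp]:
  "FSrc (G \<odot> F) = FSrc F" "FTgt (G \<odot> F) = FTgt G"
  "x \<in> Obj (FSrc F) \<Longrightarrow> FOb (G \<odot> F) x = FOb G (FOb F x)"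
  "f \<in> Arr (FSrc F) \<Longrightarrow> FAr (G \<odot> F) f = FAr G (FAr F f)"
  by (simp_all add: fcomp_def)

lemma Id_nat_simps [simp]:
  "NSrc (Id_nat F) = F" "NTgt (Id_nat F) = F"
  "x \<in> Obj (FSrc F) \<Longrightarrow> NMap (Id_nat F) x = Ident (FTgt F) (FOb F x)"
  by (simp_all add: Id_nat_def)

lemma vcomp_simps [simp]:
  "NSrc (\<beta> \<bullet> \<alpha>) = NSrc \<alpha>" "NTgt (\<beta> \<bullet> \<alpha>) = NTgt \<beta>"
  "x \<in> Obj (FSrc (NSrc \<alpha>)) \<Longrightarrow> NMap (\<beta> \<bullet> \<alpha>) x = NMap \<beta> x \<cdot>\<^bsub>FTgt (NSrc \<alpha>)\<^esub> NMap \<alpha> x"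
  by (simp_all add: vcomp_def)

lemma whisker_left_simps [simp]:
  "NSrc (G \<rhd> \<alpha>) = G \<odot> NSrc \<alpha>" "NTgt (G \<rhd> \<alpha>) = G \<odot> NTgt \<alpha>"
  "x \<in> Obj (FSrc (NSrc \<alpha>)) \<Longrightarrow> NMap (G \<rhd> \<alpha>) x = FAr G (NMap \<alpha> x)"
  by (simp_all add: whisker_left_def)

lemma whisker_right_simps [simp]:
  "NSrc (\<alpha> \<lhd> F) = NSrc \<alpha> \<odot> F" "NTgt (\<alpha> \<lhd> F) = NTgt \<alpha> \<odot> F"
  "x \<in> Obj (FSrc F) \<Longrightarrow> NMap (\<alpha> \<lhd> F) x = NMap \<alpha> (FOb F x)"
  by (simp_all add: whisker_right_def)

section \<open>Identities, composites and whiskerings\<close>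

lemma is_functor_Id: "category C \<Longrightarrow> is_functor C C (Id_functor C)"
proof (rule is_functorI)
  assume "category C"
  then interpret category C .
  fix f g
  assume "f \<in> Arr C" "g \<in> Arr C" "Cod C f = Dom C g"
  then show "FAr (Id_functor C) (g \<cdot>\<^bsub>C\<^esub> f) = FAr (Id_functor C) g \<cdot>\<^bsub>C\<^esub> FAr (Id_functor C) f"
    by simp
qed (auto simp: Id_functor_def hom_def category.Dom_Obj category.Cod_Obj category.Ident_simps)

lemma is_functor_fcomp:
  assumes "is_functor C D F" "is_functor D D' G"
  shows "is_functor C D' (G \<odot> F)"
proof -
  interpret F: is_functor C D F by fact
  interpret G: is_functor D D' G by fact
  show ?thesis
  proof (rule is_functorI)
    show "FOb (G \<odot> F) \<in> extensional (Obj C)" "FAr (G \<odot> F) \<in> extensional (Arr C)"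
      by (simp_all add: fcomp_def)
  qed (simp_all add: F.source G.target hom_def)
qed

lemma nat_trans_Id_nat:
  assumes "is_functor C D F"
  shows "nat_trans C D F F (Id_nat F)"
proof -
  interpret F: is_functor C D F by fact
  show ?thesis
    by (rule nat_transI) (simp_all add: assms hom_def, simp add: Id_nat_def)
qed

lemma nat_trans_vcomp:
  assumes "nat_trans C D F G \<alpha>" "nat_trans C D G H \<beta>"
  shows "nat_trans C D F H (\<beta> \<bullet> \<alpha>)"
proof -
  interpret \<alpha>: nat_trans C D F G \<alpha> by fact
  interpret \<beta>: nat_trans C D G H \<beta> by fact
  show ?thesis
  proof (rule nat_transI)
    show "NMap (\<beta> \<bullet> \<alpha>) \<in> extensional (Obj C)" by (simp add: vcomp_def)
  next
    fix f
    assume f [simp]: "f \<in> Arr C"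
    have "NMap \<beta> (Cod C f) \<cdot>\<^bsub>D\<^esub> (NMap \<alpha> (Cod C f) \<cdot>\<^bsub>D\<^esub> FAr F f)
        = NMap \<beta> (Cod C f) \<cdot>\<^bsub>D\<^esub> (FAr G f \<cdot>\<^bsub>D\<^esub> NMap \<alpha> (Dom C f))"
      by (simp add: \<alpha>.naturality_Arr [of f])
    also have "\<dots> = FAr H f \<cdot>\<^bsub>D\<^esub> (NMap \<beta> (Dom C f) \<cdot>\<^bsub>D\<^esub> NMap \<alpha> (Dom C f))"
      by (simp add: \<alpha>.src.tgt.Comp_extend [OF \<beta>.naturality_Arr [of f]])
    finally show "NMap (\<beta> \<bullet> \<alpha>) (Cod C f) \<cdot>\<^bsub>D\<^esub> FAr F f
        = FAr H f \<cdot>\<^bsub>D\<^esub> NMap (\<beta> \<bullet> \<alpha>) (Dom C f)"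
      by simp
  qed (simp_all add: \<alpha>.source \<beta>.target hom_def)
qed

lemma nat_trans_whisker_left:
  assumes "nat_trans C D F G \<alpha>" "is_functor D D' H"
  shows "nat_trans C D' (H \<odot> F) (H \<odot> G) (H \<rhd> \<alpha>)"
proof -
  interpret \<alpha>: nat_trans C D F G \<alpha> by fact
  interpret H: is_functor D D' H by fact
  show ?thesis
  proof (rule nat_transI)
    show "NMap (H \<rhd> \<alpha>) \<in> extensional (Obj C)" by (simp add: whisker_left_def)
  next
    fix f
    assume f [simp]: "f \<in> Arr C"
    have "FAr H (NMap \<alpha> (Cod C f) \<cdot>\<^bsub>D\<^esub> FAr F f) = FAr H (FAr G f \<cdot>\<^bsub>D\<^esub> NMap \<alpha> (Dom C f))"
      by (simp only: \<alpha>.naturality_Arr [OF f refl refl])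
    then show "NMap (H \<rhd> \<alpha>) (Cod C f) \<cdot>\<^bsub>D'\<^esub> FAr (H \<odot> F) f
        = FAr (H \<odot> G) f \<cdot>\<^bsub>D'\<^esub> NMap (H \<rhd> \<alpha>) (Dom C f)"
      by simp
  qed (simp_all add: hom_def is_functor_fcomp [OF \<alpha>.source assms(2)]
      is_functor_fcomp [OF \<alpha>.target assms(2)])
qed

lemma nat_trans_whisker_right:
  assumes "nat_trans D D' F G \<alpha>" "is_functor C D H"
  shows "nat_trans C D' (F \<odot> H) (G \<odot> H) (\<alpha> \<lhd> H)"
proof -
  interpret \<alpha>: nat_trans D D' F G \<alpha> by fact
  interpret H: is_functor C D H by fact
  show ?thesis
  proof (rule nat_transI)
    show "NMap (\<alpha> \<lhd> H) \<in> extensional (Obj C)" by (simp add: whisker_right_def)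
  qed (simp_all add: hom_def \<alpha>.naturality_Arr is_functor_fcomp [OF assms(2) \<alpha>.source]
      is_functor_fcomp [OF assms(2) \<alpha>.target])
qed

text \<open>Transformations carry their source and target functors, so differently bracketed
  composites must be identified before vertical composition typechecks in \<open>nat_trans\<close>.
  The assumptions ensure that values of \<open>F\<close> lie where the restricted maps of
  \<open>H \<odot> G\<close> are defined.\<close>

lemma fcomp_assoc:
  assumes "is_functor C1 C2 F" "is_functor C2 C3 G"
  shows "(H \<odot> G) \<odot> F = H \<odot> (G \<odot> F)"
proof -
  interpret F: is_functor C1 C2 F by fact
  interpret G: is_functor C2 C3 G by fact
  show ?thesis
    by (auto simp: fcomp_def fun_eq_iff restrict_def)
qed

lemma fcomp_Id_functor:
  assumes "is_functor C D F"
  shows "F \<odot> Id_functor C = F" "Id_functor D \<odot> F = F"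
proof -
  interpret F: is_functor C D F by fact
  have "is_functor C D (F \<odot> Id_functor C)" "is_functor C D (Id_functor D \<odot> F)"
    by (auto intro: is_functor_fcomp is_functor_Id assms F.source F.target)
  then show "F \<odot> Id_functor C = F" "Id_functor D \<odot> F = F"
    by (auto intro!: functor_eqI [OF _ assms])
qed

section \<open>Cartesian arrows\<close>

lemma cartesian_arrow_ex1:
  assumes "cartesian_arrow p f" "is_functor E B p" "g \<in> Arr E" "w \<in> Arr B"
    and "Dom B w = FOb p (Dom E g)" "Cod B w = FOb p (Dom E f)"
    and "Cod E g = Cod E f" "FAr p f \<cdot>\<^bsub>B\<^esub> w = FAr p g"
  shows "\<exists>!h. h \<in> hom E (Dom E g) (Dom E f) \<and> FAr p h = w \<and> f \<cdot>\<^bsub>E\<^esub> h = g"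
proof -
  interpret p: is_functor E B p by fact
  show ?thesis
    using assms by (auto simp: cartesian_arrow_def hom_def)
qed

text \<open>Both \<open>h\<close> and \<open>k\<close> factor the same arrow through
  \<open>f\<close> above the same base arrow, and cartesianness allows only one such
  factorization.\<close>

lemma cartesian_arrow_cancel:
  assumes f: "cartesian_arrow p f" and p: "is_functor E B p"
    and h: "h \<in> Arr E" "Cod E h = Dom E f"
    and k: "k \<in> Arr E" "Cod E k = Dom E f" "Dom E h = Dom E k"
    and eq: "FAr p h = FAr p k" "f \<cdot>\<^bsub>E\<^esub> h = f \<cdot>\<^bsub>E\<^esub> k"
  shows "h = k"
proof -
  interpret p: is_functor E B p by fact
  have f': "f \<in> Arr E" using f by (simp add: cartesian_arrow_def)
  have "FAr p f \<cdot>\<^bsub>B\<^esub> FAr p h = FAr p (f \<cdot>\<^bsub>E\<^esub> h)"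
    using f' h by simp
  then have "\<exists>!l. l \<in> hom E (Dom E (f \<cdot>\<^bsub>E\<^esub> h)) (Dom E f) \<and> FAr p l = FAr p h \<and> f \<cdot>\<^bsub>E\<^esub> l = f \<cdot>\<^bsub>E\<^esub> h"
    using f' h by (intro cartesian_arrow_ex1 [OF f p]) simp_all
  moreover have "h \<in> hom E (Dom E (f \<cdot>\<^bsub>E\<^esub> h)) (Dom E f)" "k \<in> hom E (Dom E (f \<cdot>\<^bsub>E\<^esub> h)) (Dom E f)"
    using f' h k by (simp_all add: hom_def)
  ultimately show ?thesis using eq by metis
qed

text \<open>Unfolding the functor categories turns cartesianness into a universal property stated
  purely with natural transformations. This is the form in which it is established for the pointwise
  construction and used for \<open>\<sigma>\<close>.\<close>

lemma cartesian_lifting_postcomposition_iff: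
  assumes p: "is_functor E B p"
  shows "cartesian_lifting (postcomposition X p) \<alpha> G \<sigma> \<longleftrightarrow>
    nat_trans X E (NSrc \<sigma>) G \<sigma> \<and> p \<rhd> \<sigma> = \<alpha> \<and>
    (\<forall>H \<beta> w. nat_trans X E H G \<beta> \<and> nat_trans X B (p \<odot> H) (p \<odot> NSrc \<sigma>) w \<and> \<alpha> \<bullet> w = p \<rhd> \<beta>
      \<longrightarrow> (\<exists>!h. nat_trans X E H (NSrc \<sigma>) h \<and> p \<rhd> h = w \<and> \<sigma> \<bullet> h = \<beta>))"
    (is "?lhs \<longleftrightarrow> ?rhs")
proof -
  interpret p: is_functor E B p by fact
  \<comment> \<open>The record stores source and target, so they are the only possible witnesses for
    the existential in \<open>functor_category\<close>.\<close>
  have Arr_iff: "\<beta> \<in> Arr (functor_category X E) \<longleftrightarrow> nat_trans X E (NSrc \<beta>) (NTgt \<beta>) \<beta>" for \<beta>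
    by (auto simp: functor_category_def dest: nat_trans.NSrc_eq [of X] nat_trans.NTgt_eq [of X])
  have hom_iff: "\<beta> \<in> hom (functor_category X D) F K \<longleftrightarrow> nat_trans X D F K \<beta>"
    for F K \<beta> and D :: "('x, 'y) category"
    by (auto simp: functor_category_def hom_def dest: nat_trans.NSrc_eq [of X] nat_trans.NTgt_eq [of X])
  have Obj_iff: "F \<in> Obj (functor_category X E) \<longleftrightarrow> is_functor X E F" for F
    by (simp add: functor_category_def)
  have fc: "Dom (functor_category X E) = NSrc" "Cod (functor_category X E) = NTgt"
    "Comp (functor_category X D) = vcomp" for D :: "('x, 'y) category"
    by (simp_all add: functor_category_def)
  have pc: "FSrc (postcomposition X p) = functor_category X E"
    "FTgt (postcomposition X p) = functor_category X B"
    by (simp_all add: postcomposition_def)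
  have pcO: "FOb (postcomposition X p) F = p \<odot> F" if "is_functor X E F" for F
    using that by (simp add: postcomposition_def Obj_iff)
  have pcA: "FAr (postcomposition X p) \<beta> = p \<rhd> \<beta>" if "nat_trans X E F K \<beta>" for \<beta> F K
    using that by (auto simp: postcomposition_def functor_category_def)
  show ?thesis
  proof
    assume l: ?lhs
    then have \<sigma>: "nat_trans X E (NSrc \<sigma>) G \<sigma>" and \<alpha>: "p \<rhd> \<sigma> = \<alpha>"
      using pcA [of "NSrc \<sigma>" "NTgt \<sigma>" \<sigma>]
      by (auto simp: cartesian_lifting_def cartesian_arrow_def pc fc Arr_iff)
    show ?rhs
    proof (intro conjI allI impI \<sigma> \<alpha>)
      fix H \<beta> w
      assume h: "nat_trans X E H G \<beta> \<and> nat_trans X B (p \<odot> H) (p \<odot> NSrc \<sigma>) w \<and> \<alpha> \<bullet> w = p \<rhd> \<beta>"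
      have "NSrc \<beta> = H" "NTgt \<beta> = G" "NTgt \<sigma> = G"
        using h \<sigma> by (auto dest: nat_trans.NSrc_eq [of X] nat_trans.NTgt_eq [of X])
      with l h \<sigma> show "\<exists>!h. nat_trans X E H (NSrc \<sigma>) h \<and> p \<rhd> h = w \<and> \<sigma> \<bullet> h = \<beta>"
        unfolding cartesian_lifting_def cartesian_arrow_def pc fc hom_iff
        apply -
        apply (elim conjE)
        apply (drule bspec [where x = \<beta>])
         apply (simp add: Arr_iff)
        apply (drule bspec [where x = w])
         apply (simp add: hom_iff pcO nat_trans.source)
        apply (simp add: pcA cong: conj_cong)
        done
    qed
  next
    assume r: ?rhs
    then have \<sigma>: "nat_trans X E (NSrc \<sigma>) G \<sigma>" and \<alpha>: "p \<rhd> \<sigma> = \<alpha>" and G: "NTgt \<sigma> = G"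
      by (auto dest: nat_trans.NTgt_eq [of X])
    show ?lhs
      unfolding cartesian_lifting_def cartesian_arrow_def pc fc hom_iff
    proof (intro conjI ballI impI)
      fix \<beta> w
      assume \<beta>: "\<beta> \<in> Arr (functor_category X E)"
        and w: "w \<in> hom (functor_category X B) (FOb (postcomposition X p) (NSrc \<beta>))
          (FOb (postcomposition X p) (NSrc \<sigma>))"
        and eq: "NTgt \<beta> = NTgt \<sigma> \<and> FAr (postcomposition X p) \<sigma> \<bullet> w = FAr (postcomposition X p) \<beta>"
      have \<beta>': "nat_trans X E (NSrc \<beta>) G \<beta>" using \<beta> eq G by (simp add: Arr_iff)
      have "nat_trans X B (p \<odot> NSrc \<beta>) (p \<odot> NSrc \<sigma>) w"
        using w \<sigma> \<beta>' by (simp add: hom_iff pcO nat_trans.source)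
      moreover have "\<alpha> \<bullet> w = p \<rhd> \<beta>" using eq \<sigma> \<beta>' \<alpha> by (simp add: pcA)
      ultimately have "\<exists>!h. nat_trans X E (NSrc \<beta>) (NSrc \<sigma>) h \<and> p \<rhd> h = w \<and> \<sigma> \<bullet> h = \<beta>"
        using r \<beta>' by blast
      then show "\<exists>!h. nat_trans X E (NSrc \<beta>) (NSrc \<sigma>) h \<and>
          FAr (postcomposition X p) h = w \<and> \<sigma> \<bullet> h = \<beta>"
        by (simp add: pcA cong: conj_cong)
    qed (use \<sigma> \<alpha> G in \<open>simp_all add: Arr_iff pcA\<close>)
  qed
qed

text \<open>Existence in the fibration gives the components, and uniqueness of factorizations does
  the rest: it makes the domains of the chosen liftings into a functor, and it makes pointwise
  factorizations natural and unique.\<close>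

lemma cartesian_lifting_postcomposition_ex:
  assumes fib: "fibration E B p" and G: "is_functor X E G"
    and \<alpha>: "nat_trans X B H (p \<odot> G) \<alpha>"
  shows "\<exists>\<sigma>. cartesian_lifting (postcomposition X p) \<alpha> G \<sigma>"
proof -
  have p: "is_functor E B p" using fib by (simp add: fibration_def)
  interpret p: is_functor E B p by fact
  interpret G: is_functor X E G by fact
  interpret \<alpha>: nat_trans X B H "p \<odot> G" \<alpha> by fact
  have "\<exists>s. \<forall>x\<in>Obj X. cartesian_lifting p (NMap \<alpha> x) (FOb G x) (s x)"
    using fib by (intro bchoice) (simp add: fibration_def)
  then obtain s where s: "\<And>x. x \<in> Obj X \<Longrightarrow> cartesian_lifting p (NMap \<alpha> x) (FOb G x) (s x)"
    by blast
  have cart: "cartesian_arrow p (s x)"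
    and s_simps [simp]: "s x \<in> Arr E" "Cod E (s x) = FOb G x" "FAr p (s x) = NMap \<alpha> x"
    if "x \<in> Obj X" for x
    using s [OF that] by (simp_all add: cartesian_lifting_def cartesian_arrow_def)
  have p_dom [simp]: "FOb p (Dom E (s x)) = FOb H x" if "x \<in> Obj X" for x
    using that \<alpha>.NMap_simps(2) [OF that] p.FAr_simps(2) [of "s x"] by simp
  \<comment> \<open>The action of the new functor on \<open>f\<close> is the factorization of
    \<open>FAr G f\<close> after \<open>s (Dom X f)\<close> through the cartesian
    \<open>s (Cod X f)\<close>, taken above \<open>FAr H f\<close>. Naturality of
    \<open>\<alpha>\<close> is exactly the condition that this factorization problem is well
    posed.\<close>
  have "\<exists>t. \<forall>f\<in>Arr X. t f \<in> hom E (Dom E (s (Dom X f))) (Dom E (s (Cod X f))) \<and>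
      FAr p (t f) = FAr H f \<and> s (Cod X f) \<cdot>\<^bsub>E\<^esub> t f = FAr G f \<cdot>\<^bsub>E\<^esub> s (Dom X f)"
  proof (intro bchoice ballI)
    fix f assume f [simp]: "f \<in> Arr X"
    have "\<exists>!h. h \<in> hom E (Dom E (FAr G f \<cdot>\<^bsub>E\<^esub> s (Dom X f))) (Dom E (s (Cod X f))) \<and>
        FAr p h = FAr H f \<and> s (Cod X f) \<cdot>\<^bsub>E\<^esub> h = FAr G f \<cdot>\<^bsub>E\<^esub> s (Dom X f)"
      by (rule cartesian_arrow_ex1 [OF cart p]) (simp_all add: \<alpha>.naturality_Arr [of f])
    then show "\<exists>h. h \<in> hom E (Dom E (s (Dom X f))) (Dom E (s (Cod X f))) \<and>
        FAr p h = FAr H f \<and> s (Cod X f) \<cdot>\<^bsub>E\<^esub> h = FAr G f \<cdot>\<^bsub>E\<^esub> s (Dom X f)"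
      by auto
  qed
  then obtain t where t: "\<And>f. f \<in> Arr X \<Longrightarrow>
      t f \<in> hom E (Dom E (s (Dom X f))) (Dom E (s (Cod X f))) \<and>
      FAr p (t f) = FAr H f \<and> s (Cod X f) \<cdot>\<^bsub>E\<^esub> t f = FAr G f \<cdot>\<^bsub>E\<^esub> s (Dom X f)"
    by blast
  have t_simps [simp]: "t f \<in> Arr E" "Dom E (t f) = Dom E (s (Dom X f))"
    "Cod E (t f) = Dom E (s (Cod X f))" "FAr p (t f) = FAr H f"
    and s_t: "s (Cod X f) \<cdot>\<^bsub>E\<^esub> t f = FAr G f \<cdot>\<^bsub>E\<^esub> s (Dom X f)" if "f \<in> Arr X" for f
    using t [OF that] by (simp_all add: hom_def)
  define T where "T = \<lparr>FSrc = X, FTgt = E, FOb = (\<lambda>x\<in>Obj X. Dom E (s x)), FAr = (\<lambda>f\<in>Arr X. t f)\<rparr>"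
  have T_simps [simp]: "FSrc T = X" "FTgt T = E"
    "x \<in> Obj X \<Longrightarrow> FOb T x = Dom E (s x)" "f \<in> Arr X \<Longrightarrow> FAr T f = t f" for x f
    by (simp_all add: T_def)
  have T: "is_functor X E T"
  proof (rule is_functorI)
    fix x assume x [simp]: "x \<in> Obj X"
    \<comment> \<open>Both sides factor \<open>s x\<close> through itself above an identity;
      preservation of composites below is obtained by the same cancellation.\<close>
    have "t (Ident X x) = Ident E (Dom E (s x))"
      by (rule cartesian_arrow_cancel [OF cart [OF x] p]) (use s_t [of "Ident X x"] in simp_all)
    then show "FAr T (Ident X x) = Ident E (FOb T x)" by simp
  next
    fix f g assume [simp]: "f \<in> Arr X" "g \<in> Arr X" and fg [simp]: "Cod X f = Dom X g"
    have "s (Cod X g) \<cdot>\<^bsub>E\<^esub> (t g \<cdot>\<^bsub>E\<^esub> t f) = (FAr G g \<cdot>\<^bsub>E\<^esub> s (Dom X g)) \<cdot>\<^bsub>E\<^esub> t f"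
      by (rule p.src.Comp_extend [OF s_t]) simp_all
    also have "\<dots> = FAr G g \<cdot>\<^bsub>E\<^esub> (FAr G f \<cdot>\<^bsub>E\<^esub> s (Dom X f))"
      using s_t [of f] by simp
    finally have eq: "s (Cod X g) \<cdot>\<^bsub>E\<^esub> (t g \<cdot>\<^bsub>E\<^esub> t f)
        = FAr G g \<cdot>\<^bsub>E\<^esub> (FAr G f \<cdot>\<^bsub>E\<^esub> s (Dom X f))" .
    have "t (g \<cdot>\<^bsub>X\<^esub> f) = t g \<cdot>\<^bsub>E\<^esub> t f"
      by (rule cartesian_arrow_cancel [OF cart [of "Cod X g"] p]) (use eq s_t [of "g \<cdot>\<^bsub>X\<^esub> f"] in simp_all)
    then show "FAr T (g \<cdot>\<^bsub>X\<^esub> f) = FAr T g \<cdot>\<^bsub>E\<^esub> FAr T f" by simp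
  qed (simp_all add: T_def hom_def G.source p.source)
  interpret T: is_functor X E T by fact
  have pT: "p \<odot> T = H"
    by (rule functor_eqI [OF is_functor_fcomp [OF T p] \<alpha>.source]) simp_all
  define \<sigma> where "\<sigma> = \<lparr>NSrc = T, NTgt = G, NMap = (\<lambda>x\<in>Obj X. s x)\<rparr>"
  have \<sigma>_simps [simp]: "NSrc \<sigma> = T" "NTgt \<sigma> = G" "x \<in> Obj X \<Longrightarrow> NMap \<sigma> x = s x" for x
    by (simp_all add: \<sigma>_def)
  have \<sigma>: "nat_trans X E T G \<sigma>"
    by (rule nat_transI) (simp_all add: T G hom_def s_t, simp add: \<sigma>_def)
  have p\<sigma>: "p \<rhd> \<sigma> = \<alpha>"
    by (rule nat_trans_eqI [OF _ \<alpha>]) (use nat_trans_whisker_left [OF \<sigma> p] pT in simp_all)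
  have "\<exists>!h. nat_trans X E K T h \<and> p \<rhd> h = w \<and> \<sigma> \<bullet> h = \<beta>"
    if \<beta>: "nat_trans X E K G \<beta>" and w: "nat_trans X B (p \<odot> K) (p \<odot> T) w" and eq: "\<alpha> \<bullet> w = p \<rhd> \<beta>"
    for K \<beta> w
  proof -
    interpret \<beta>: nat_trans X E K G \<beta> by fact
    interpret w: nat_trans X B "p \<odot> K" "p \<odot> T" w by fact
    have eq': "NMap \<alpha> x \<cdot>\<^bsub>B\<^esub> NMap w x = FAr p (NMap \<beta> x)" if "x \<in> Obj X" for x
      using that arg_cong [OF eq, of "\<lambda>\<gamma>. NMap \<gamma> x"] by simp
    have "\<exists>k. \<forall>x\<in>Obj X. k x \<in> hom E (FOb K x) (Dom E (s x)) \<and>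
        FAr p (k x) = NMap w x \<and> s x \<cdot>\<^bsub>E\<^esub> k x = NMap \<beta> x"
    proof (intro bchoice ballI)
      fix x assume x [simp]: "x \<in> Obj X"
      have "\<exists>!k. k \<in> hom E (Dom E (NMap \<beta> x)) (Dom E (s x)) \<and>
          FAr p k = NMap w x \<and> s x \<cdot>\<^bsub>E\<^esub> k = NMap \<beta> x"
        by (rule cartesian_arrow_ex1 [OF cart p]) (simp_all add: eq')
      then show "\<exists>k. k \<in> hom E (FOb K x) (Dom E (s x)) \<and>
          FAr p k = NMap w x \<and> s x \<cdot>\<^bsub>E\<^esub> k = NMap \<beta> x"
        by auto
    qed
    then obtain k where k: "\<And>x. x \<in> Obj X \<Longrightarrow> k x \<in> hom E (FOb K x) (Dom E (s x)) \<and>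
        FAr p (k x) = NMap w x \<and> s x \<cdot>\<^bsub>E\<^esub> k x = NMap \<beta> x"
      by blast
    have k_simps [simp]: "k x \<in> Arr E" "Dom E (k x) = FOb K x" "Cod E (k x) = Dom E (s x)"
      "FAr p (k x) = NMap w x" and s_k [simp]: "s x \<cdot>\<^bsub>E\<^esub> k x = NMap \<beta> x" if "x \<in> Obj X" for x
      using k [OF that] by (simp_all add: hom_def)
    define h where "h = \<lparr>NSrc = K, NTgt = T, NMap = (\<lambda>x\<in>Obj X. k x)\<rparr>"
    have h_simps [simp]: "NSrc h = K" "NTgt h = T" "x \<in> Obj X \<Longrightarrow> NMap h x = k x" for x
      by (simp_all add: h_def)
    have h: "nat_trans X E K T h"
    proof (rule nat_transI)
      fix f assume f [simp]: "f \<in> Arr X"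
      have "s (Cod X f) \<cdot>\<^bsub>E\<^esub> (k (Cod X f) \<cdot>\<^bsub>E\<^esub> FAr K f) = NMap \<beta> (Cod X f) \<cdot>\<^bsub>E\<^esub> FAr K f"
        by (rule p.src.Comp_extend [OF s_k]) simp_all
      also have "\<dots> = FAr G f \<cdot>\<^bsub>E\<^esub> NMap \<beta> (Dom X f)"
        by (simp add: \<beta>.naturality_Arr)
      also have "\<dots> = s (Cod X f) \<cdot>\<^bsub>E\<^esub> (t f \<cdot>\<^bsub>E\<^esub> k (Dom X f))"
        by (simp add: p.src.Comp_extend [OF s_t])
      finally have eq: "s (Cod X f) \<cdot>\<^bsub>E\<^esub> (k (Cod X f) \<cdot>\<^bsub>E\<^esub> FAr K f)
          = s (Cod X f) \<cdot>\<^bsub>E\<^esub> (t f \<cdot>\<^bsub>E\<^esub> k (Dom X f))" .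
      \<comment> \<open>The two composites agree after \<open>s (Cod X f)\<close> by
        \<open>eq\<close>, and their images under \<open>p\<close> agree by naturality of
        \<open>w\<close>.\<close>
      have "k (Cod X f) \<cdot>\<^bsub>E\<^esub> FAr K f = t f \<cdot>\<^bsub>E\<^esub> k (Dom X f)"
        by (rule cartesian_arrow_cancel [OF cart [of "Cod X f"] p]) (use eq w.naturality_Arr [of f] in simp_all)
      then show "NMap h (Cod X f) \<cdot>\<^bsub>E\<^esub> FAr K f = FAr T f \<cdot>\<^bsub>E\<^esub> NMap h (Dom X f)"
        by simp
    qed (simp_all add: T \<beta>.source hom_def, simp add: h_def)
    show ?thesis
    proof (rule ex1I [of _ h], intro conjI h)
      show "p \<rhd> h = w"
        by (rule nat_trans_eqI [OF nat_trans_whisker_left [OF h p] w]) simp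
      show "\<sigma> \<bullet> h = \<beta>"
        by (rule nat_trans_eqI [OF nat_trans_vcomp [OF h \<sigma>] \<beta>]) simp
    next
      fix l assume l: "nat_trans X E K T l \<and> p \<rhd> l = w \<and> \<sigma> \<bullet> l = \<beta>"
      then interpret l: nat_trans X E K T l by simp
      show "l = h"
      proof (rule nat_trans_eqI [OF l.nat_trans_axioms h])
        fix x assume x [simp]: "x \<in> Obj X"
        have "NMap (p \<rhd> l) x = NMap w x" "NMap (\<sigma> \<bullet> l) x = NMap \<beta> x"
          using l by simp_all
        then have eq: "FAr p (NMap l x) = NMap w x" "s x \<cdot>\<^bsub>E\<^esub> NMap l x = NMap \<beta> x"
          by simp_all
        show "NMap l x = NMap h x"
          by (rule cartesian_arrow_cancel [OF cart [OF x] p]) (use eq in simp_all)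
      qed
    qed
  qed
  then show ?thesis
    using \<sigma> p\<sigma> unfolding cartesian_lifting_postcomposition_iff [OF p] by (intro exI [of _ \<sigma>]) auto
qed

section \<open>Codensity monads\<close>

text \<open>The universal property supplies the unique existence that the definite description in
  \<open>kan_transpose\<close> presupposes.\<close>

lemma kan_transpose_spec:
  assumes "right_kan_extension A C D S F L c" "is_functor C D H" "nat_trans A D (H \<odot> S) F \<gamma>"
  shows "nat_trans C D H L (kan_transpose C D S L c H \<gamma>)"
    and "c \<bullet> kan_transpose C D S L c H \<gamma> \<lhd> S = \<gamma>"
proof -
  have "\<exists>!\<beta>. nat_trans C D H L \<beta> \<and> c \<bullet> \<beta> \<lhd> S = \<gamma>"
    using assms by (simp add: right_kan_extension_def)
  from theI' [OF this] show "nat_trans C D H L (kan_transpose C D S L c H \<gamma>)"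
    "c \<bullet> kan_transpose C D S L c H \<gamma> \<lhd> S = \<gamma>"
    by (simp_all add: kan_transpose_def)
qed

text \<open>Both transformations are transposes of the same
  \<open>c \<bullet> \<beta> \<lhd> S\<close>. Because the hypothesis speaks of components, an
  equation between transformations into \<open>L\<close> reduces to a calculation at the objects
  \<open>FOb S a\<close>.\<close>

lemma right_kan_extension_cancel:
  assumes kan: "right_kan_extension A C D S F L c"
    and \<alpha>: "nat_trans C D H L \<alpha>" and \<beta>: "nat_trans C D H L \<beta>"
    and eq: "\<And>a. a \<in> Obj A \<Longrightarrow> NMap c a \<cdot>\<^bsub>D\<^esub> NMap \<alpha> (FOb S a) = NMap c a \<cdot>\<^bsub>D\<^esub> NMap \<beta> (FOb S a)"
  shows "\<alpha> = \<beta>"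
proof -
  interpret \<alpha>: nat_trans C D H L \<alpha> by fact
  interpret \<beta>: nat_trans C D H L \<beta> by fact
  have S: "is_functor A C S" and c: "nat_trans A D (L \<odot> S) F c"
    using kan by (simp_all add: right_kan_extension_def)
  interpret S: is_functor A C S by fact
  have \<alpha>S: "nat_trans A D (H \<odot> S) F (c \<bullet> \<alpha> \<lhd> S)" and \<beta>S: "nat_trans A D (H \<odot> S) F (c \<bullet> \<beta> \<lhd> S)"
    by (rule nat_trans_vcomp [OF nat_trans_whisker_right [OF _ S] c], fact)+
  have "c \<bullet> \<alpha> \<lhd> S = c \<bullet> \<beta> \<lhd> S"
    by (rule nat_trans_eqI [OF \<alpha>S \<beta>S]) (simp add: eq)
  moreover have "\<exists>!\<delta>. nat_trans C D H L \<delta> \<and> c \<bullet> \<delta> \<lhd> S = c \<bullet> \<beta> \<lhd> S"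
    using kan \<beta>S \<alpha>.source by (simp add: right_kan_extension_def)
  ultimately show ?thesis using \<alpha> \<beta> by blast
qed

section \<open>The codensity monad of \<open>S\<close> and its laws\<close>

locale codensity =
  fixes A :: "('oa, 'aa) category" and E :: "('oe, 'ae) category"
    and S :: "('oa, 'aa, 'oe, 'ae) functr"
    and G :: "('oe, 'ae, 'oe, 'ae) functr" and c :: "('oa, 'aa, 'oe, 'ae) nattrans"
  assumes kan: "right_kan_extension A E E S S G c"
begin

sublocale S: is_functor A E S using kan by (simp add: right_kan_extension_def)

sublocale G: is_functor E E G using kan by (simp add: right_kan_extension_def)

sublocale c: nat_trans A E "G \<odot> S" S c using kan by (simp add: right_kan_extension_def)

abbreviation u where "u \<equiv> codensity_unit E S G c"

abbreviation m where "m \<equiv> codensity_mult E S G c"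

lemma Id_nat_S: "nat_trans A E (Id_functor E \<odot> S) S (Id_nat S)"
  using nat_trans_Id_nat [OF S.is_functor_axioms]
  by (simp add: fcomp_Id_functor [OF S.is_functor_axioms])

lemma c_G_c: "nat_trans A E ((G \<odot> G) \<odot> S) S (c \<bullet> G \<rhd> c)"
  using nat_trans_vcomp [OF nat_trans_whisker_left [OF c.nat_trans_axioms G.is_functor_axioms]
      c.nat_trans_axioms]
  by (simp add: fcomp_assoc [OF S.is_functor_axioms G.is_functor_axioms])

sublocale u: nat_trans E E "Id_functor E" G u
  unfolding codensity_unit_def
  by (rule kan_transpose_spec [OF kan is_functor_Id [OF G.source] Id_nat_S])

sublocale m: nat_trans E E "G \<odot> G" G m
  unfolding codensity_mult_def
  by (rule kan_transpose_spec [OF kan is_functor_fcomp [OF G.is_functor_axioms G.is_functor_axioms] c_G_c])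

text \<open>The equations \<open>c_u\<close> and \<open>c_m\<close> are the defining equations of
  the transposes \<open>u\<close> and \<open>m\<close>. Together they say that
  \<open>NMap c a\<close> is an algebra structure on \<open>FOb S a\<close> for the codensity
  monad.\<close>

lemma c_u:
  assumes "a \<in> Obj A"
  shows "NMap c a \<cdot>\<^bsub>E\<^esub> NMap u (FOb S a) = Ident E (FOb S a)"
proof -
  have "c \<bullet> u \<lhd> S = Id_nat S"
    unfolding codensity_unit_def
    by (rule kan_transpose_spec [OF kan is_functor_Id [OF G.source] Id_nat_S])
  then have "NMap (c \<bullet> u \<lhd> S) a = NMap (Id_nat S) a" by simp
  then show ?thesis using assms by simp
qed

lemma c_m:
  assumes "a \<in> Obj A"
  shows "NMap c a \<cdot>\<^bsub>E\<^esub> NMap m (FOb S a) = NMap c a \<cdot>\<^bsub>E\<^esub> FAr G (NMap c a)"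
proof -
  have "c \<bullet> m \<lhd> S = c \<bullet> G \<rhd> c"
    unfolding codensity_mult_def
    by (rule kan_transpose_spec
        [OF kan is_functor_fcomp [OF G.is_functor_axioms G.is_functor_axioms] c_G_c])
  then have "NMap (c \<bullet> m \<lhd> S) a = NMap (c \<bullet> G \<rhd> c) a" by simp
  then show ?thesis using assms by simp
qed

text \<open>By cancellation along \<open>c\<close> it suffices to compare after \<open>c\<close>:
  there \<open>c_m\<close> replaces \<open>m\<close> by \<open>G c\<close>, naturality of
  \<open>u\<close> exchanges this with \<open>c\<close>, and \<open>c_u\<close> removes
  \<open>u\<close>.\<close>

lemma m_uG:
  assumes "x \<in> Obj E"
  shows "NMap m x \<cdot>\<^bsub>E\<^esub> NMap u (FOb G x) = Ident E (FOb G x)"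
proof -
  have "m \<bullet> u \<lhd> G = Id_nat G"
  proof (rule right_kan_extension_cancel [OF kan])
    show "nat_trans E E G G (Id_nat G)" by (rule nat_trans_Id_nat) unfold_locales
    show "nat_trans E E G G (m \<bullet> u \<lhd> G)"
      using nat_trans_vcomp [OF nat_trans_whisker_right [OF u.nat_trans_axioms G.is_functor_axioms]
          m.nat_trans_axioms]
      by (simp add: fcomp_Id_functor [OF G.is_functor_axioms])
    fix a assume a [simp]: "a \<in> Obj A"
    have "NMap c a \<cdot>\<^bsub>E\<^esub> (NMap m (FOb S a) \<cdot>\<^bsub>E\<^esub> NMap u (FOb G (FOb S a)))
        = NMap c a \<cdot>\<^bsub>E\<^esub> (FAr G (NMap c a) \<cdot>\<^bsub>E\<^esub> NMap u (FOb G (FOb S a)))"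
      by (simp add: S.tgt.Comp_extend [OF c_m])
    also have "\<dots> = NMap c a \<cdot>\<^bsub>E\<^esub> (NMap u (FOb S a) \<cdot>\<^bsub>E\<^esub> NMap c a)"
      using u.naturality_Arr [of "NMap c a" "FOb G (FOb S a)" "FOb S a"] by simp
    also have "\<dots> = NMap c a"
      by (simp add: S.tgt.Comp_extend [OF c_u])
    finally show "NMap c a \<cdot>\<^bsub>E\<^esub> NMap (m \<bullet> u \<lhd> G) (FOb S a)
        = NMap c a \<cdot>\<^bsub>E\<^esub> NMap (Id_nat G) (FOb S a)"
      by simp
  qed
  then have "NMap (m \<bullet> u \<lhd> G) x = NMap (Id_nat G) x" by simp
  then show ?thesis using assms by simp
qed

text \<open>After \<open>c\<close>, the equation \<open>c_m\<close> replaces \<open>m\<close> by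
  \<open>G c\<close>; functoriality of \<open>G\<close> then exposes \<open>c\<close> after
  \<open>u\<close>, which is an identity by \<open>c_u\<close>.\<close>

lemma m_Gu:
  assumes "x \<in> Obj E"
  shows "NMap m x \<cdot>\<^bsub>E\<^esub> FAr G (NMap u x) = Ident E (FOb G x)"
proof -
  have "m \<bullet> G \<rhd> u = Id_nat G"
  proof (rule right_kan_extension_cancel [OF kan])
    show "nat_trans E E G G (Id_nat G)" by (rule nat_trans_Id_nat) unfold_locales
    show "nat_trans E E G G (m \<bullet> G \<rhd> u)"
      using nat_trans_vcomp [OF nat_trans_whisker_left [OF u.nat_trans_axioms G.is_functor_axioms]
          m.nat_trans_axioms]
      by (simp add: fcomp_Id_functor [OF G.is_functor_axioms])
    fix a assume a [simp]: "a \<in> Obj A"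
    have "NMap c a \<cdot>\<^bsub>E\<^esub> (NMap m (FOb S a) \<cdot>\<^bsub>E\<^esub> FAr G (NMap u (FOb S a)))
        = NMap c a \<cdot>\<^bsub>E\<^esub> (FAr G (NMap c a) \<cdot>\<^bsub>E\<^esub> FAr G (NMap u (FOb S a)))"
      by (simp add: S.tgt.Comp_extend [OF c_m])
    also have "\<dots> = NMap c a \<cdot>\<^bsub>E\<^esub> FAr G (NMap c a \<cdot>\<^bsub>E\<^esub> NMap u (FOb S a))"
      by simp
    also have "\<dots> = NMap c a"
      by (simp only: c_u [OF a]) simp
    finally show "NMap c a \<cdot>\<^bsub>E\<^esub> NMap (m \<bullet> G \<rhd> u) (FOb S a)
        = NMap c a \<cdot>\<^bsub>E\<^esub> NMap (Id_nat G) (FOb S a)"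
      by simp
  qed
  then have "NMap (m \<bullet> G \<rhd> u) x = NMap (Id_nat G) x" by simp
  then show ?thesis using assms by simp
qed

text \<open>After \<open>c\<close>, both sides become \<open>c\<close> after \<open>G c\<close>
  after \<open>G G c\<close>. The left side needs naturality of \<open>m\<close> at
  \<open>c\<close>, the right side functoriality of \<open>G\<close>.\<close>

lemma m_mG:
  assumes "x \<in> Obj E"
  shows "NMap m x \<cdot>\<^bsub>E\<^esub> NMap m (FOb G x) = NMap m x \<cdot>\<^bsub>E\<^esub> FAr G (NMap m x)"
proof -
  have "m \<bullet> m \<lhd> G = m \<bullet> G \<rhd> m"
  proof (rule right_kan_extension_cancel [OF kan])
    show "nat_trans E E ((G \<odot> G) \<odot> G) G (m \<bullet> m \<lhd> G)"
      by (rule nat_trans_vcomp [OF nat_trans_whisker_right m.nat_trans_axioms]) unfold_locales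
    show "nat_trans E E ((G \<odot> G) \<odot> G) G (m \<bullet> G \<rhd> m)"
      unfolding fcomp_assoc [OF G.is_functor_axioms G.is_functor_axioms]
      by (rule nat_trans_vcomp [OF nat_trans_whisker_left m.nat_trans_axioms]) unfold_locales
    fix a assume a [simp]: "a \<in> Obj A"
    have "NMap c a \<cdot>\<^bsub>E\<^esub> (NMap m (FOb S a) \<cdot>\<^bsub>E\<^esub> NMap m (FOb G (FOb S a)))
        = NMap c a \<cdot>\<^bsub>E\<^esub> (FAr G (NMap c a) \<cdot>\<^bsub>E\<^esub> NMap m (FOb G (FOb S a)))"
      by (simp add: S.tgt.Comp_extend [OF c_m])
    also have "\<dots> = NMap c a \<cdot>\<^bsub>E\<^esub> (NMap m (FOb S a) \<cdot>\<^bsub>E\<^esub> FAr G (FAr G (NMap c a)))"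
      using m.naturality_Arr [of "NMap c a" "FOb G (FOb S a)" "FOb S a"] by simp
    also have "\<dots> = NMap c a \<cdot>\<^bsub>E\<^esub> FAr G (NMap c a \<cdot>\<^bsub>E\<^esub> FAr G (NMap c a))"
      by (simp add: S.tgt.Comp_extend [OF c_m])
    also have "\<dots> = NMap c a \<cdot>\<^bsub>E\<^esub> FAr G (NMap c a \<cdot>\<^bsub>E\<^esub> NMap m (FOb S a))"
      by (simp only: c_m [OF a])
    also have "\<dots> = NMap c a \<cdot>\<^bsub>E\<^esub> (NMap m (FOb S a) \<cdot>\<^bsub>E\<^esub> FAr G (NMap m (FOb S a)))"
      by (simp add: S.tgt.Comp_extend [OF c_m])
    finally show "NMap c a \<cdot>\<^bsub>E\<^esub> NMap (m \<bullet> m \<lhd> G) (FOb S a)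
        = NMap c a \<cdot>\<^bsub>E\<^esub> NMap (m \<bullet> G \<rhd> m) (FOb S a)"
      by simp
  qed
  then have "NMap (m \<bullet> m \<lhd> G) x = NMap (m \<bullet> G \<rhd> m) x" by simp
  then show ?thesis using assms by simp
qed

end

section \<open>The comparison transformation\<close>

context is_monad
begin

sublocale MFun: is_functor C C "MFun \<T>" by (rule functor_MFun)

sublocale MUnit: nat_trans C C "Id_functor C" "MFun \<T>" "MUnit \<T>" by (rule nat_MUnit)

sublocale MMult: nat_trans C C "MFun \<T> \<odot> MFun \<T>" "MFun \<T>" "MMult \<T>" by (rule nat_MMult)

lemma
  assumes [simp]: "x \<in> Obj C"
  shows left_unit_NMap:
      "NMap (MMult \<T>) x \<cdot>\<^bsub>C\<^esub> NMap (MUnit \<T>) (FOb (MFun \<T>) x) = Ident C (FOb (MFun \<T>) x)"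
    and right_unit_NMap:
      "NMap (MMult \<T>) x \<cdot>\<^bsub>C\<^esub> FAr (MFun \<T>) (NMap (MUnit \<T>) x) = Ident C (FOb (MFun \<T>) x)"
    and assoc_NMap:
      "NMap (MMult \<T>) x \<cdot>\<^bsub>C\<^esub> NMap (MMult \<T>) (FOb (MFun \<T>) x)
        = NMap (MMult \<T>) x \<cdot>\<^bsub>C\<^esub> FAr (MFun \<T>) (NMap (MMult \<T>) x)"
  using arg_cong [OF left_unit, of "\<lambda>\<gamma>. NMap \<gamma> x"] arg_cong [OF right_unit, of "\<lambda>\<gamma>. NMap \<gamma> x"]
    arg_cong [OF assoc, of "\<lambda>\<gamma>. NMap \<gamma> x"]
  by simp_all

end

text \<open>All that the codensity lifting uses of the lifting parameter is the transformation
  \<open>\<xi> = K\<epsilon>R : T p S \<rightarrow> p S\<close>, which makes every \<open>p S a\<close> an algebra of the monad.\<close>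

locale codensity_algebra = codensity A E S G c + p: is_functor E B p + T: is_monad B \<T>
  for A :: "('oa, 'aa) category" and E :: "('oe, 'ae) category"
    and S :: "('oa, 'aa, 'oe, 'ae) functr"
    and G :: "('oe, 'ae, 'oe, 'ae) functr" and c :: "('oa, 'aa, 'oe, 'ae) nattrans"
    and B :: "('ob, 'ab) category" and p :: "('oe, 'ae, 'ob, 'ab) functr"
    and \<T> :: "('ob, 'ab) monad" +
  fixes \<xi> :: "('oa, 'aa, 'ob, 'ab) nattrans"
  assumes kan_p: "right_kan_extension A E B S (p \<odot> S) (p \<odot> G) (p \<rhd> c)"
    and nat_\<xi>: "nat_trans A B ((MFun \<T> \<odot> p) \<odot> S) (p \<odot> S) \<xi>"
    and \<xi>_unit: "a \<in> Obj A \<Longrightarrow>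
      NMap \<xi> a \<cdot>\<^bsub>B\<^esub> NMap (MUnit \<T>) (FOb p (FOb S a)) = Ident B (FOb p (FOb S a))"
    and \<xi>_mult: "a \<in> Obj A \<Longrightarrow>
      NMap \<xi> a \<cdot>\<^bsub>B\<^esub> NMap (MMult \<T>) (FOb p (FOb S a)) = NMap \<xi> a \<cdot>\<^bsub>B\<^esub> FAr (MFun \<T>) (NMap \<xi> a)"
begin

abbreviation T where "T \<equiv> MFun \<T>"

abbreviation \<eta> where "\<eta> \<equiv> MUnit \<T>"

abbreviation \<mu> where "\<mu> \<equiv> MMult \<T>"

definition \<alpha> where "\<alpha> = kan_transpose E B S (p \<odot> G) (p \<rhd> c) (T \<odot> p) \<xi>"

lemma functor_Tp: "is_functor E B (T \<odot> p)"
  by (rule is_functor_fcomp [OF p.is_functor_axioms T.functor_MFun])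

sublocale \<xi>: nat_trans A B "(T \<odot> p) \<odot> S" "p \<odot> S" \<xi> by (rule nat_\<xi>)

sublocale \<alpha>: nat_trans E B "T \<odot> p" "p \<odot> G" \<alpha>
  unfolding \<alpha>_def by (rule kan_transpose_spec [OF kan_p functor_Tp nat_\<xi>])

lemma pc_\<alpha>:
  assumes "a \<in> Obj A"
  shows "FAr p (NMap c a) \<cdot>\<^bsub>B\<^esub> NMap \<alpha> (FOb S a) = NMap \<xi> a"
proof -
  have "(p \<rhd> c) \<bullet> \<alpha> \<lhd> S = \<xi>"
    unfolding \<alpha>_def by (rule kan_transpose_spec [OF kan_p functor_Tp nat_\<xi>])
  then have "NMap ((p \<rhd> c) \<bullet> \<alpha> \<lhd> S) a = NMap \<xi> a" by simp
  then show ?thesis using assms by simp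
qed

text \<open>This is the algebra law \<open>\<xi>_unit\<close> transposed along the Kan extension:
  after \<open>p c\<close> both sides are identities, on the left by \<open>\<xi>_unit\<close> and
  on the right by \<open>c_u\<close>.\<close>

lemma \<alpha>_\<eta>:
  assumes "x \<in> Obj E"
  shows "NMap \<alpha> x \<cdot>\<^bsub>B\<^esub> NMap \<eta> (FOb p x) = FAr p (NMap u x)"
proof -
  have "\<alpha> \<bullet> \<eta> \<lhd> p = p \<rhd> u"
  proof (rule right_kan_extension_cancel [OF kan_p])
    show "nat_trans E B p (p \<odot> G) (\<alpha> \<bullet> \<eta> \<lhd> p)"
      using nat_trans_vcomp [OF nat_trans_whisker_right [OF T.nat_MUnit p.is_functor_axioms]
          \<alpha>.nat_trans_axioms]
      by (simp add: fcomp_Id_functor [OF p.is_functor_axioms])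
    show "nat_trans E B p (p \<odot> G) (p \<rhd> u)"
      using nat_trans_whisker_left [OF u.nat_trans_axioms p.is_functor_axioms]
      by (simp add: fcomp_Id_functor [OF p.is_functor_axioms])
    fix a assume a [simp]: "a \<in> Obj A"
    have "FAr p (NMap c a) \<cdot>\<^bsub>B\<^esub> (NMap \<alpha> (FOb S a) \<cdot>\<^bsub>B\<^esub> NMap \<eta> (FOb p (FOb S a)))
        = FAr p (NMap c a \<cdot>\<^bsub>E\<^esub> NMap u (FOb S a))"
      \<comment> \<open>Functoriality of \<open>p\<close> is switched off so that \<open>c\<close>
        after \<open>u\<close> remains a single composite for \<open>c_u\<close>.\<close>
      by (simp add: p.tgt.Comp_extend [OF pc_\<alpha>] \<xi>_unit c_u del: p.FAr_Comp_Arr)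
    then show "NMap (p \<rhd> c) a \<cdot>\<^bsub>B\<^esub> NMap (\<alpha> \<bullet> \<eta> \<lhd> p) (FOb S a)
        = NMap (p \<rhd> c) a \<cdot>\<^bsub>B\<^esub> NMap (p \<rhd> u) (FOb S a)"
      by simp
  qed
  then have "NMap (\<alpha> \<bullet> \<eta> \<lhd> p) x = NMap (p \<rhd> u) x" by simp
  then show ?thesis using assms by simp
qed

text \<open>Both sides become \<open>\<xi>\<close> after \<open>T \<xi>\<close> when composed with
  \<open>p c\<close>. The left side does so by \<open>\<xi>_mult\<close>; the right side does so by
  \<open>c_m\<close>, naturality of \<open>\<alpha>\<close> at \<open>c\<close>, and two uses of
  \<open>pc_\<alpha>\<close>.\<close>

lemma \<alpha>_\<mu>:
  assumes "x \<in> Obj E"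
  shows "NMap \<alpha> x \<cdot>\<^bsub>B\<^esub> NMap \<mu> (FOb p x)
    = FAr p (NMap m x) \<cdot>\<^bsub>B\<^esub> (NMap \<alpha> (FOb G x) \<cdot>\<^bsub>B\<^esub> FAr T (NMap \<alpha> x))"
proof -
  have assoc: "(T \<odot> T) \<odot> p = T \<odot> (T \<odot> p)" "(T \<odot> p) \<odot> G = T \<odot> (p \<odot> G)" "(p \<odot> G) \<odot> G = p \<odot> (G \<odot> G)"
    by (rule fcomp_assoc; unfold_locales)+
  have "\<alpha> \<bullet> \<mu> \<lhd> p = (p \<rhd> m) \<bullet> (\<alpha> \<lhd> G) \<bullet> (T \<rhd> \<alpha>)"
  proof (rule right_kan_extension_cancel [OF kan_p])
    show "nat_trans E B ((T \<odot> T) \<odot> p) (p \<odot> G) (\<alpha> \<bullet> \<mu> \<lhd> p)"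
      by (rule nat_trans_vcomp [OF nat_trans_whisker_right \<alpha>.nat_trans_axioms]) unfold_locales
    have "nat_trans E B (T \<odot> (T \<odot> p)) (T \<odot> (p \<odot> G)) (T \<rhd> \<alpha>)"
      by (rule nat_trans_whisker_left) unfold_locales
    moreover have "nat_trans E B ((T \<odot> p) \<odot> G) ((p \<odot> G) \<odot> G) (\<alpha> \<lhd> G)"
      by (rule nat_trans_whisker_right) unfold_locales
    moreover have "nat_trans E B (p \<odot> (G \<odot> G)) (p \<odot> G) (p \<rhd> m)"
      by (rule nat_trans_whisker_left) unfold_locales
    ultimately show "nat_trans E B ((T \<odot> T) \<odot> p) (p \<odot> G) ((p \<rhd> m) \<bullet> (\<alpha> \<lhd> G) \<bullet> (T \<rhd> \<alpha>))"
      unfolding assoc by (blast intro: nat_trans_vcomp)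
    fix a assume a [simp]: "a \<in> Obj A"
    have "FAr p (NMap c a) \<cdot>\<^bsub>B\<^esub> (NMap \<alpha> (FOb S a) \<cdot>\<^bsub>B\<^esub> NMap \<mu> (FOb p (FOb S a)))
        = NMap \<xi> a \<cdot>\<^bsub>B\<^esub> FAr T (NMap \<xi> a)"
      by (simp add: p.tgt.Comp_extend [OF pc_\<alpha>] \<xi>_mult)
    also have "\<dots> = NMap \<xi> a \<cdot>\<^bsub>B\<^esub> FAr T (FAr p (NMap c a) \<cdot>\<^bsub>B\<^esub> NMap \<alpha> (FOb S a))"
      by (simp only: pc_\<alpha> [OF a])
    also have "\<dots> = FAr p (NMap c a) \<cdot>\<^bsub>B\<^esub> (NMap \<alpha> (FOb S a) \<cdot>\<^bsub>B\<^esub>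
        (FAr T (FAr p (NMap c a)) \<cdot>\<^bsub>B\<^esub> FAr T (NMap \<alpha> (FOb S a))))"
      by (simp add: p.tgt.Comp_extend [OF pc_\<alpha>])
    also have "\<dots> = FAr p (NMap c a) \<cdot>\<^bsub>B\<^esub> (FAr p (FAr G (NMap c a)) \<cdot>\<^bsub>B\<^esub>
        (NMap \<alpha> (FOb G (FOb S a)) \<cdot>\<^bsub>B\<^esub> FAr T (NMap \<alpha> (FOb S a))))"
      using p.tgt.Comp_extend [OF \<alpha>.naturality_Arr [of "NMap c a" "FOb G (FOb S a)" "FOb S a"]]
      by simp
    also have "\<dots> = FAr p (NMap c a \<cdot>\<^bsub>E\<^esub> FAr G (NMap c a)) \<cdot>\<^bsub>B\<^esub>
        (NMap \<alpha> (FOb G (FOb S a)) \<cdot>\<^bsub>B\<^esub> FAr T (NMap \<alpha> (FOb S a)))"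
      by simp
    also have "\<dots> = FAr p (NMap c a) \<cdot>\<^bsub>B\<^esub> (FAr p (NMap m (FOb S a)) \<cdot>\<^bsub>B\<^esub>
        (NMap \<alpha> (FOb G (FOb S a)) \<cdot>\<^bsub>B\<^esub> FAr T (NMap \<alpha> (FOb S a))))"
      by (simp only: c_m [OF a, symmetric]) simp
    finally show "NMap (p \<rhd> c) a \<cdot>\<^bsub>B\<^esub> NMap (\<alpha> \<bullet> \<mu> \<lhd> p) (FOb S a)
        = NMap (p \<rhd> c) a \<cdot>\<^bsub>B\<^esub> NMap ((p \<rhd> m) \<bullet> (\<alpha> \<lhd> G) \<bullet> (T \<rhd> \<alpha>)) (FOb S a)"
      by simp
  qed
  then have "NMap (\<alpha> \<bullet> \<mu> \<lhd> p) x = NMap ((p \<rhd> m) \<bullet> (\<alpha> \<lhd> G) \<bullet> (T \<rhd> \<alpha>)) x" by simp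
  then show ?thesis using assms by simp
qed

end

section \<open>The codensity lifting\<close>

locale codensity_algebra_lifting = codensity_algebra +
  fixes \<sigma>
  assumes cartesian_\<sigma>: "cartesian_lifting (postcomposition E p) \<alpha> G \<sigma>"
begin

definition T' where "T' = NSrc \<sigma>"

lemma cartesian_lifting_\<sigma>:
  "nat_trans E E T' G \<sigma>" "p \<rhd> \<sigma> = \<alpha>"
  "\<lbrakk>nat_trans E E H G \<beta>; nat_trans E B (p \<odot> H) (p \<odot> T') w; \<alpha> \<bullet> w = p \<rhd> \<beta>\<rbrakk>
    \<Longrightarrow> \<exists>!h. nat_trans E E H T' h \<and> p \<rhd> h = w \<and> \<sigma> \<bullet> h = \<beta>"
  using cartesian_\<sigma> unfolding cartesian_lifting_postcomposition_iff [OF p.is_functor_axioms] T'_def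
  by blast+

sublocale \<sigma>: nat_trans E E T' G \<sigma> by (rule cartesian_lifting_\<sigma>)

text \<open>The record equation between \<open>p \<rhd> \<sigma>\<close> and \<open>\<alpha>\<close>
  also equates their sources, which gives the strict equality of functors that a lifting
  demands.\<close>

lemma p_T': "p \<odot> T' = T \<odot> p"
  using arg_cong [OF cartesian_lifting_\<sigma>(2), of NSrc] by simp

lemma p_FOb_T' [simp]: "x \<in> Obj E \<Longrightarrow> FOb p (FOb T' x) = FOb T (FOb p x)"
  using arg_cong [OF p_T', of "\<lambda>F. FOb F x"] by simp

lemma p_FAr_T' [simp]: "f \<in> Arr E \<Longrightarrow> FAr p (FAr T' f) = FAr T (FAr p f)"
  using arg_cong [OF p_T', of "\<lambda>F. FAr F f"] by simp

lemma p_\<sigma> [simp]: "x \<in> Obj E \<Longrightarrow> FAr p (NMap \<sigma> x) = NMap \<alpha> x"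
  using arg_cong [OF cartesian_lifting_\<sigma>(2), of "\<lambda>\<gamma>. NMap \<gamma> x"] by simp

text \<open>Both \<open>h\<close> and \<open>k\<close> factor \<open>\<sigma> \<bullet> k\<close>
  through the cartesian \<open>\<sigma>\<close> above \<open>p \<rhd> k\<close>. Each monad law thus
  splits into a calculation in \<open>B\<close>, where the laws of \<open>\<T>\<close> apply, and
  one in \<open>E\<close>, where those of the codensity monad apply.\<close>

lemma \<sigma>_cancel:
  assumes h: "nat_trans E E H T' h" and k: "nat_trans E E H T' k"
    and p_eq: "\<And>x. x \<in> Obj E \<Longrightarrow> FAr p (NMap h x) = FAr p (NMap k x)"
    and \<sigma>_eq: "\<And>x. x \<in> Obj E \<Longrightarrow> NMap \<sigma> x \<cdot>\<^bsub>E\<^esub> NMap h x = NMap \<sigma> x \<cdot>\<^bsub>E\<^esub> NMap k x"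
  shows "h = k"
proof -
  interpret h: nat_trans E E H T' h by fact
  interpret k: nat_trans E E H T' k by fact
  have ph: "nat_trans E B (p \<odot> H) (p \<odot> T') (p \<rhd> h)" and pk: "nat_trans E B (p \<odot> H) (p \<odot> T') (p \<rhd> k)"
    by (rule nat_trans_whisker_left; unfold_locales)+
  have \<sigma>h: "nat_trans E E H G (\<sigma> \<bullet> h)" and \<sigma>k: "nat_trans E E H G (\<sigma> \<bullet> k)"
    by (rule nat_trans_vcomp [OF _ \<sigma>.nat_trans_axioms]; fact)+
  have "p \<rhd> h = p \<rhd> k" by (rule nat_trans_eqI [OF ph pk]) (simp add: p_eq)
  moreover have "\<sigma> \<bullet> h = \<sigma> \<bullet> k" by (rule nat_trans_eqI [OF \<sigma>h \<sigma>k]) (simp add: \<sigma>_eq)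
  moreover have "\<exists>!l. nat_trans E E H T' l \<and> p \<rhd> l = p \<rhd> k \<and> \<sigma> \<bullet> l = \<sigma> \<bullet> k"
  proof (rule cartesian_lifting_\<sigma>(3) [OF \<sigma>k pk])
    have \<alpha>: "nat_trans E B (p \<odot> T') (p \<odot> G) \<alpha>"
      unfolding p_T' by unfold_locales
    have "nat_trans E B (p \<odot> H) (p \<odot> G) (p \<rhd> (\<sigma> \<bullet> k))"
      by (rule nat_trans_whisker_left [OF \<sigma>k]) unfold_locales
    then show "\<alpha> \<bullet> (p \<rhd> k) = p \<rhd> (\<sigma> \<bullet> k)"
      by (rule nat_trans_eqI [OF nat_trans_vcomp [OF pk \<alpha>]]) simp
  qed
  ultimately show ?thesis using h k by metis
qed

section \<open>Unit and multiplication of the codensity lifting\<close>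

abbreviation \<eta>' where "\<eta>' \<equiv> MUnit (codensity_lifting E p \<T> S G c \<sigma>)"

abbreviation \<mu>' where "\<mu>' \<equiv> MMult (codensity_lifting E p \<T> S G c \<sigma>)"

text \<open>By \<open>\<alpha>_\<eta>\<close>, the transformation \<open>\<eta> \<lhd> p\<close> is
  an admissible base for factoring \<open>u\<close> through \<open>\<sigma>\<close>. The
  factorization is unique, so the definite description in \<open>codensity_lifting\<close> denotes
  it.\<close>

lemma \<eta>': "nat_trans E E (Id_functor E) T' \<eta>' \<and> p \<rhd> \<eta>' = \<eta> \<lhd> p \<and> \<sigma> \<bullet> \<eta>' = u"
proof -
  have p_Id: "p \<odot> Id_functor E = p" "Id_functor B \<odot> p = p"
    by (rule fcomp_Id_functor, unfold_locales)+
  have \<eta>p: "nat_trans E B p (T \<odot> p) (\<eta> \<lhd> p)"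
    using nat_trans_whisker_right [OF T.nat_MUnit p.is_functor_axioms] by (simp add: p_Id)
  have pu: "nat_trans E B p (p \<odot> G) (p \<rhd> u)"
    using nat_trans_whisker_left [OF u.nat_trans_axioms p.is_functor_axioms] by (simp add: p_Id)
  have "\<alpha> \<bullet> \<eta> \<lhd> p = p \<rhd> u"
    by (rule nat_trans_eqI [OF nat_trans_vcomp [OF \<eta>p \<alpha>.nat_trans_axioms] pu]) (simp add: \<alpha>_\<eta>)
  then have "\<exists>!h. nat_trans E E (Id_functor E) T' h \<and> p \<rhd> h = \<eta> \<lhd> p \<and> \<sigma> \<bullet> h = u"
    by (intro cartesian_lifting_\<sigma>(3)) (simp_all add: p_Id p_T' \<eta>p u.nat_trans_axioms)
  from theI' [OF this] show ?thesis
    by (simp add: codensity_lifting_def Let_def)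
qed

text \<open>The same argument as for the unit, with \<open>\<alpha>_\<mu>\<close> providing the
  compatibility in the base.\<close>

lemma \<mu>': "nat_trans E E (T' \<odot> T') T' \<mu>' \<and> p \<rhd> \<mu>' = \<mu> \<lhd> p \<and> \<sigma> \<bullet> \<mu>' = m \<bullet> \<sigma> \<lhd> G \<bullet> T' \<rhd> \<sigma>"
proof -
  \<comment> \<open>Each of the two copies of \<open>T'\<close> is moved past \<open>p\<close> by
    \<open>p_T'\<close>, so that \<open>\<mu> \<lhd> p\<close> has the required source.\<close>
  have assoc: "p \<odot> (T' \<odot> T') = (T \<odot> T) \<odot> p"
  proof -
    have "p \<odot> (T' \<odot> T') = (T \<odot> p) \<odot> T'"
      unfolding p_T' [symmetric] by (rule fcomp_assoc [symmetric]; unfold_locales)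
    also have "\<dots> = T \<odot> (p \<odot> T')" by (rule fcomp_assoc; unfold_locales)
    also have "\<dots> = (T \<odot> T) \<odot> p"
      unfolding p_T' by (rule fcomp_assoc [symmetric]; unfold_locales)
    finally show ?thesis .
  qed
  have \<mu>p: "nat_trans E B ((T \<odot> T) \<odot> p) (T \<odot> p) (\<mu> \<lhd> p)"
    by (rule nat_trans_whisker_right; unfold_locales)
  have "nat_trans E E (T' \<odot> T') (T' \<odot> G) (T' \<rhd> \<sigma>)"
    by (rule nat_trans_whisker_left; unfold_locales)
  moreover have "nat_trans E E (T' \<odot> G) (G \<odot> G) (\<sigma> \<lhd> G)"
    by (rule nat_trans_whisker_right; unfold_locales)
  ultimately have \<beta>: "nat_trans E E (T' \<odot> T') G (m \<bullet> \<sigma> \<lhd> G \<bullet> T' \<rhd> \<sigma>)"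
    using m.nat_trans_axioms by (blast intro: nat_trans_vcomp)
  have p\<beta>: "nat_trans E B ((T \<odot> T) \<odot> p) (p \<odot> G) (p \<rhd> (m \<bullet> \<sigma> \<lhd> G \<bullet> T' \<rhd> \<sigma>))"
    unfolding assoc [symmetric] by (rule nat_trans_whisker_left [OF \<beta>]) unfold_locales
  \<comment> \<open>Applying \<open>p\<close> turns \<open>\<sigma>\<close> into
    \<open>\<alpha>\<close> and \<open>T'\<close> into \<open>T\<close>, so the right side becomes
    that of \<open>\<alpha>_\<mu>\<close>.\<close>
  have "\<alpha> \<bullet> \<mu> \<lhd> p = p \<rhd> (m \<bullet> \<sigma> \<lhd> G \<bullet> T' \<rhd> \<sigma>)"
    by (rule nat_trans_eqI [OF nat_trans_vcomp [OF \<mu>p \<alpha>.nat_trans_axioms] p\<beta>]) (simp add: \<alpha>_\<mu>)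
  then have "\<exists>!h. nat_trans E E (T' \<odot> T') T' h \<and> p \<rhd> h = \<mu> \<lhd> p \<and> \<sigma> \<bullet> h = m \<bullet> \<sigma> \<lhd> G \<bullet> T' \<rhd> \<sigma>"
    by (intro cartesian_lifting_\<sigma>(3) [OF \<beta>]) (simp_all add: p_T' assoc \<mu>p)
  from theI' [OF this] show ?thesis
    by (simp add: codensity_lifting_def Let_def)
qed

sublocale \<eta>': nat_trans E E "Id_functor E" T' \<eta>' by (rule \<eta>' [THEN conjunct1])

sublocale \<mu>': nat_trans E E "T' \<odot> T'" T' \<mu>' by (rule \<mu>' [THEN conjunct1])

lemma
  assumes [simp]: "x \<in> Obj E"
  shows p_\<eta>' [simp]: "FAr p (NMap \<eta>' x) = NMap \<eta> (FOb p x)"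
    and p_\<mu>' [simp]: "FAr p (NMap \<mu>' x) = NMap \<mu> (FOb p x)"
    and \<sigma>_\<eta>': "NMap \<sigma> x \<cdot>\<^bsub>E\<^esub> NMap \<eta>' x = NMap u x"
    and \<sigma>_\<mu>': "NMap \<sigma> x \<cdot>\<^bsub>E\<^esub> NMap \<mu>' x
      = NMap m x \<cdot>\<^bsub>E\<^esub> (NMap \<sigma> (FOb G x) \<cdot>\<^bsub>E\<^esub> FAr T' (NMap \<sigma> x))"
proof -
  have "NMap (p \<rhd> \<eta>') x = NMap (\<eta> \<lhd> p) x" "NMap (\<sigma> \<bullet> \<eta>') x = NMap u x"
    using \<eta>' by simp_all
  then show "FAr p (NMap \<eta>' x) = NMap \<eta> (FOb p x)" "NMap \<sigma> x \<cdot>\<^bsub>E\<^esub> NMap \<eta>' x = NMap u x"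
    by simp_all
  have "NMap (p \<rhd> \<mu>') x = NMap (\<mu> \<lhd> p) x" "NMap (\<sigma> \<bullet> \<mu>') x = NMap (m \<bullet> \<sigma> \<lhd> G \<bullet> T' \<rhd> \<sigma>) x"
    using \<mu>' by simp_all
  then show "FAr p (NMap \<mu>' x) = NMap \<mu> (FOb p x)"
    "NMap \<sigma> x \<cdot>\<^bsub>E\<^esub> NMap \<mu>' x = NMap m x \<cdot>\<^bsub>E\<^esub> (NMap \<sigma> (FOb G x) \<cdot>\<^bsub>E\<^esub> FAr T' (NMap \<sigma> x))"
    by simp_all
qed

text \<open>Under \<open>p\<close> this is the left unit law of \<open>\<T>\<close>. After
  \<open>\<sigma>\<close>, naturality of \<open>\<eta>'\<close> at \<open>\<sigma>\<close> reduces
  it to \<open>m_uG\<close>.\<close>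

lemma \<mu>'_\<eta>'_T': "\<mu>' \<bullet> \<eta>' \<lhd> T' = Id_nat T'"
proof (rule \<sigma>_cancel)
  show "nat_trans E E T' T' (Id_nat T')" by (rule nat_trans_Id_nat) unfold_locales
  show "nat_trans E E T' T' (\<mu>' \<bullet> \<eta>' \<lhd> T')"
    using nat_trans_vcomp [OF nat_trans_whisker_right [OF \<eta>'.nat_trans_axioms \<sigma>.source]
        \<mu>'.nat_trans_axioms]
    by (simp add: fcomp_Id_functor [OF \<sigma>.source])
  fix x assume x [simp]: "x \<in> Obj E"
  show "FAr p (NMap (\<mu>' \<bullet> \<eta>' \<lhd> T') x) = FAr p (NMap (Id_nat T') x)"
    by (simp add: T.left_unit_NMap)
  have "NMap \<sigma> x \<cdot>\<^bsub>E\<^esub> (NMap \<mu>' x \<cdot>\<^bsub>E\<^esub> NMap \<eta>' (FOb T' x))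
      = NMap m x \<cdot>\<^bsub>E\<^esub> (NMap \<sigma> (FOb G x) \<cdot>\<^bsub>E\<^esub> (FAr T' (NMap \<sigma> x) \<cdot>\<^bsub>E\<^esub> NMap \<eta>' (FOb T' x)))"
    by (simp add: S.tgt.Comp_extend [OF \<sigma>_\<mu>'])
  also have "\<dots> = NMap m x \<cdot>\<^bsub>E\<^esub> (NMap \<sigma> (FOb G x) \<cdot>\<^bsub>E\<^esub> (NMap \<eta>' (FOb G x) \<cdot>\<^bsub>E\<^esub> NMap \<sigma> x))"
    using \<eta>'.naturality_Arr [of "NMap \<sigma> x" "FOb T' x" "FOb G x"] by simp
  also have "\<dots> = NMap \<sigma> x"
    by (simp add: S.tgt.Comp_extend [OF \<sigma>_\<eta>'] S.tgt.Comp_extend [OF m_uG])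
  finally show "NMap \<sigma> x \<cdot>\<^bsub>E\<^esub> NMap (\<mu>' \<bullet> \<eta>' \<lhd> T') x = NMap \<sigma> x \<cdot>\<^bsub>E\<^esub> NMap (Id_nat T') x"
    by simp
qed

text \<open>Under \<open>p\<close> this is the right unit law of \<open>\<T>\<close>. After
  \<open>\<sigma>\<close>, naturality of \<open>\<sigma>\<close> at \<open>u\<close> reduces it to
  \<open>m_Gu\<close>.\<close>

lemma \<mu>'_T'_\<eta>': "\<mu>' \<bullet> T' \<rhd> \<eta>' = Id_nat T'"
proof (rule \<sigma>_cancel)
  show "nat_trans E E T' T' (Id_nat T')" by (rule nat_trans_Id_nat) unfold_locales
  show "nat_trans E E T' T' (\<mu>' \<bullet> T' \<rhd> \<eta>')"
    using nat_trans_vcomp [OF nat_trans_whisker_left [OF \<eta>'.nat_trans_axioms \<sigma>.source]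
        \<mu>'.nat_trans_axioms]
    by (simp add: fcomp_Id_functor [OF \<sigma>.source])
  fix x assume x [simp]: "x \<in> Obj E"
  show "FAr p (NMap (\<mu>' \<bullet> T' \<rhd> \<eta>') x) = FAr p (NMap (Id_nat T') x)"
    by (simp add: T.right_unit_NMap)
  have "NMap \<sigma> x \<cdot>\<^bsub>E\<^esub> (NMap \<mu>' x \<cdot>\<^bsub>E\<^esub> FAr T' (NMap \<eta>' x))
      = NMap m x \<cdot>\<^bsub>E\<^esub> (NMap \<sigma> (FOb G x) \<cdot>\<^bsub>E\<^esub> FAr T' (NMap \<sigma> x \<cdot>\<^bsub>E\<^esub> NMap \<eta>' x))"
    by (simp add: S.tgt.Comp_extend [OF \<sigma>_\<mu>'])
  also have "\<dots> = NMap m x \<cdot>\<^bsub>E\<^esub> (FAr G (NMap u x) \<cdot>\<^bsub>E\<^esub> NMap \<sigma> x)"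
    \<comment> \<open>The rewriting with \<open>\<sigma>_\<eta>'\<close> comes first, while the
      argument of \<open>T'\<close> is still one composite; the full simplifier would split it by
      functoriality.\<close>
    using \<sigma>.naturality_Arr [of "NMap u x" x "FOb G x"] by (simp only: \<sigma>_\<eta>' [OF x]) simp
  also have "\<dots> = NMap \<sigma> x"
    by (simp add: S.tgt.Comp_extend [OF m_Gu])
  finally show "NMap \<sigma> x \<cdot>\<^bsub>E\<^esub> NMap (\<mu>' \<bullet> T' \<rhd> \<eta>') x = NMap \<sigma> x \<cdot>\<^bsub>E\<^esub> NMap (Id_nat T') x"
    by simp
qed

text \<open>Under \<open>p\<close> this is associativity of \<open>\<T>\<close>. After
  \<open>\<sigma>\<close>, naturality of \<open>\<mu>'\<close> at \<open>\<sigma>\<close> on one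
  side and of \<open>\<sigma>\<close> at \<open>m\<close> on the other leave the two sides of
  \<open>m_mG\<close>, preceded by a common arrow.\<close>

lemma \<mu>'_\<mu>'_T': "\<mu>' \<bullet> \<mu>' \<lhd> T' = \<mu>' \<bullet> T' \<rhd> \<mu>'"
proof (rule \<sigma>_cancel)
  show "nat_trans E E ((T' \<odot> T') \<odot> T') T' (\<mu>' \<bullet> \<mu>' \<lhd> T')"
    by (rule nat_trans_vcomp [OF nat_trans_whisker_right \<mu>'.nat_trans_axioms]) unfold_locales
  show "nat_trans E E ((T' \<odot> T') \<odot> T') T' (\<mu>' \<bullet> T' \<rhd> \<mu>')"
    unfolding fcomp_assoc [OF \<sigma>.source \<sigma>.source]
    by (rule nat_trans_vcomp [OF nat_trans_whisker_left \<mu>'.nat_trans_axioms]) unfold_locales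
  fix x assume x [simp]: "x \<in> Obj E"
  show "FAr p (NMap (\<mu>' \<bullet> \<mu>' \<lhd> T') x) = FAr p (NMap (\<mu>' \<bullet> T' \<rhd> \<mu>') x)"
    by (simp add: T.assoc_NMap)
  \<comment> \<open>This common arrow is the component at \<open>x\<close> of the horizontal
    composite of three copies of \<open>\<sigma>\<close>, from \<open>T' T' T'\<close> to
    \<open>G G G\<close>.\<close>
  let ?f = "NMap \<sigma> (FOb G (FOb G x)) \<cdot>\<^bsub>E\<^esub> (FAr T' (NMap \<sigma> (FOb G x)) \<cdot>\<^bsub>E\<^esub> FAr T' (FAr T' (NMap \<sigma> x)))"
  have "NMap \<sigma> x \<cdot>\<^bsub>E\<^esub> (NMap \<mu>' x \<cdot>\<^bsub>E\<^esub> NMap \<mu>' (FOb T' x))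
      = NMap m x \<cdot>\<^bsub>E\<^esub> (NMap \<sigma> (FOb G x) \<cdot>\<^bsub>E\<^esub> (FAr T' (NMap \<sigma> x) \<cdot>\<^bsub>E\<^esub> NMap \<mu>' (FOb T' x)))"
    by (simp add: S.tgt.Comp_extend [OF \<sigma>_\<mu>'])
  also have "\<dots> = NMap m x \<cdot>\<^bsub>E\<^esub> (NMap \<sigma> (FOb G x) \<cdot>\<^bsub>E\<^esub> (NMap \<mu>' (FOb G x) \<cdot>\<^bsub>E\<^esub> FAr T' (FAr T' (NMap \<sigma> x))))"
    using \<mu>'.naturality_Arr [of "NMap \<sigma> x" "FOb T' x" "FOb G x"] by simp
  also have "\<dots> = NMap m x \<cdot>\<^bsub>E\<^esub> (NMap m (FOb G x) \<cdot>\<^bsub>E\<^esub> ?f)"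
    by (simp add: S.tgt.Comp_extend [OF \<sigma>_\<mu>'])
  also have "\<dots> = NMap m x \<cdot>\<^bsub>E\<^esub> (FAr G (NMap m x) \<cdot>\<^bsub>E\<^esub> ?f)"
    by (simp add: S.tgt.Comp_extend [OF m_mG])
  also have "\<dots> = NMap m x \<cdot>\<^bsub>E\<^esub> (NMap \<sigma> (FOb G x) \<cdot>\<^bsub>E\<^esub> FAr T' (NMap m x \<cdot>\<^bsub>E\<^esub>
      (NMap \<sigma> (FOb G x) \<cdot>\<^bsub>E\<^esub> FAr T' (NMap \<sigma> x))))"
    using S.tgt.Comp_extend [OF \<sigma>.naturality_Arr [of "NMap m x" "FOb G (FOb G x)" "FOb G x"]] by simp
  also have "\<dots> = NMap m x \<cdot>\<^bsub>E\<^esub> (NMap \<sigma> (FOb G x) \<cdot>\<^bsub>E\<^esub> FAr T' (NMap \<sigma> x \<cdot>\<^bsub>E\<^esub> NMap \<mu>' x))"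
    by (simp only: \<sigma>_\<mu>' [OF x])
  also have "\<dots> = NMap \<sigma> x \<cdot>\<^bsub>E\<^esub> (NMap \<mu>' x \<cdot>\<^bsub>E\<^esub> FAr T' (NMap \<mu>' x))"
    by (simp add: S.tgt.Comp_extend [OF \<sigma>_\<mu>'])
  finally show "NMap \<sigma> x \<cdot>\<^bsub>E\<^esub> NMap (\<mu>' \<bullet> \<mu>' \<lhd> T') x = NMap \<sigma> x \<cdot>\<^bsub>E\<^esub> NMap (\<mu>' \<bullet> T' \<rhd> \<mu>') x"
    by simp
qed

lemma MFun_codensity_lifting [simp]: "MFun (codensity_lifting E p \<T> S G c \<sigma>) = T'"
  by (simp add: codensity_lifting_def Let_def)

lemma is_monad_codensity_lifting: "is_monad E (codensity_lifting E p \<T> S G c \<sigma>)"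
  by (rule is_monad.intro)
    (simp_all add: \<sigma>.source \<eta>'.nat_trans_axioms \<mu>'.nat_trans_axioms \<mu>'_\<eta>'_T' \<mu>'_T'_\<eta>' \<mu>'_\<mu>'_T')

lemma is_lifting_codensity_lifting: "is_lifting E p \<T> (codensity_lifting E p \<T> S G c \<sigma>)"
  using is_monad_codensity_lifting \<eta>' \<mu>' by (simp add: is_lifting_def p_T')

end

text \<open>The counit at \<open>y\<close> is represented by the identity of \<open>T y\<close>,
  which \<open>K\<close> sends to the multiplication at \<open>y\<close>. Hence \<open>\<xi>\<close>
  equips \<open>p S a\<close>, which is \<open>T (R a)\<close>, with the free algebra structure on
  \<open>R a\<close>.\<close>

lemma lifting_parameter_algebra:
  assumes T: "is_monad B \<T>" and p: "is_functor E B p" and par: "lifting_parameter A E B p \<T> R S"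
  defines "\<xi> \<equiv> kleisli_K B \<T> \<rhd> kleisli_counit B \<T> \<lhd> R"
  shows "nat_trans A B ((MFun \<T> \<odot> p) \<odot> S) (p \<odot> S) \<xi>"
    and "a \<in> Obj A \<Longrightarrow> NMap \<xi> a = NMap (MMult \<T>) (FOb R a)"
    and "a \<in> Obj A \<Longrightarrow> FOb R a \<in> Obj B"
    and "a \<in> Obj A \<Longrightarrow> FOb p (FOb S a) = FOb (MFun \<T>) (FOb R a)"
proof -
  interpret T: is_monad B \<T> by fact
  interpret p: is_functor E B p by fact
  interpret R: is_functor A "kleisli B \<T>" R using par by (simp add: lifting_parameter_def)
  interpret S: is_functor A E S using par by (simp add: lifting_parameter_def)
  have KR: "kleisli_K B \<T> \<odot> R = p \<odot> S" using par by (simp add: lifting_parameter_def)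
  have R_Obj: "FOb R a \<in> Obj B" if "a \<in> Obj A" for a
    using R.FOb_Obj [OF that] by (simp add: kleisli_def)
  have K_FOb: "FOb (kleisli_K B \<T>) y = FOb (MFun \<T>) y" if "y \<in> Obj B" for y
    using that by (simp add: kleisli_K_def)
  have K_FAr: "FAr (kleisli_K B \<T>) (f, y) = NMap (MMult \<T>) y \<cdot>\<^bsub>B\<^esub> FAr (MFun \<T>) f"
    if "(f, y) \<in> Arr (kleisli B \<T>)" for f y
    using that by (simp add: kleisli_K_def)
  have pS: "FOb p (FOb S a) = FOb (MFun \<T>) (FOb R a)" if "a \<in> Obj A" for a
    using that arg_cong [OF KR, of "\<lambda>F. FOb F a"] by (simp add: K_FOb R_Obj)
  have \<xi>_NMap: "NMap \<xi> a = NMap (MMult \<T>) (FOb R a)" if "a \<in> Obj A" for a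
    using that unfolding \<xi>_def
    by (simp add: kleisli_counit_def R_Obj K_FAr kleisli_def whisker_left_def whisker_right_def)
  show "a \<in> Obj A \<Longrightarrow> NMap \<xi> a = NMap (MMult \<T>) (FOb R a)"
    "a \<in> Obj A \<Longrightarrow> FOb R a \<in> Obj B"
    "a \<in> Obj A \<Longrightarrow> FOb p (FOb S a) = FOb (MFun \<T>) (FOb R a)"
    by (fact \<xi>_NMap R_Obj pS)+
  have K_J: "FOb (kleisli_K B \<T>) (FOb (kleisli_J B \<T>) x) = FOb (MFun \<T>) x" if "x \<in> Obj B" for x
    using that by (simp add: K_FOb kleisli_J_def)
  \<comment> \<open>Functoriality of \<open>T\<close> gives multiplication after
    \<open>T \<eta>\<close> after \<open>T f\<close>, and the right unit law cancels the first
    two.\<close>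
  have K_J_FAr: "FAr (kleisli_K B \<T>) (FAr (kleisli_J B \<T>) f) = FAr (MFun \<T>) f"
    if f [simp]: "f \<in> Arr B" for f
  proof -
    have J: "FAr (kleisli_J B \<T>) f = (NMap (MUnit \<T>) (Cod B f) \<cdot>\<^bsub>B\<^esub> f, Cod B f)"
      by (simp add: kleisli_J_def)
    have "(NMap (MUnit \<T>) (Cod B f) \<cdot>\<^bsub>B\<^esub> f, Cod B f) \<in> Arr (kleisli B \<T>)"
      by (simp add: kleisli_def)
    then show ?thesis
      by (simp add: J K_FAr T.MFun.src.Comp_extend [OF T.right_unit_NMap])
  qed
  have KR_FOb: "FOb (kleisli_K B \<T>) (FOb R a) = FOb p (FOb S a)" if "a \<in> Obj A" for a
    using that by (simp add: K_FOb R_Obj pS)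
  have KR_FAr: "FAr (kleisli_K B \<T>) (FAr R f) = FAr p (FAr S f)" if "f \<in> Arr A" for f
    using that arg_cong [OF KR, of "\<lambda>F. FAr F f"] by simp
  have pS_FAr: "FAr p (FAr S f) = NMap (MMult \<T>) (FOb R (Cod A f)) \<cdot>\<^bsub>B\<^esub> FAr (MFun \<T>) (fst (FAr R f))"
    and R_FAr: "fst (FAr R f) \<in> Arr B" "Dom B (fst (FAr R f)) = FOb R (Dom A f)"
      "Cod B (fst (FAr R f)) = FOb (MFun \<T>) (FOb R (Cod A f))"
    if f: "f \<in> Arr A" for f
  proof -
    \<comment> \<open>A Kleisli arrow is a pair, and the pattern in \<open>kleisli_K\<close> needs
      it split; \<open>y\<close> is the recorded codomain, hence
      \<open>FOb R (Cod A f)\<close>.\<close>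
    obtain r y where r: "FAr R f = (r, y)" by fastforce
    have in_Arr: "(r, y) \<in> Arr (kleisli B \<T>)" and y: "y = FOb R (Cod A f)"
      and dom: "Dom B r = FOb R (Dom A f)"
      using R.FAr_simps [OF f] by (simp_all add: r) (simp_all add: kleisli_def)
    show "FAr p (FAr S f) = NMap (MMult \<T>) (FOb R (Cod A f)) \<cdot>\<^bsub>B\<^esub> FAr (MFun \<T>) (fst (FAr R f))"
      using KR_FAr [OF f] K_FAr [OF in_Arr] by (simp add: r y)
    show "fst (FAr R f) \<in> Arr B" "Dom B (fst (FAr R f)) = FOb R (Dom A f)"
      "Cod B (fst (FAr R f)) = FOb (MFun \<T>) (FOb R (Cod A f))"
      using in_Arr by (simp_all add: r dom) (simp_all add: kleisli_def y)
  qed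
  have K_FSrc: "FSrc (kleisli_K B \<T>) = kleisli B \<T>" "FTgt (kleisli_K B \<T>) = B"
    by (simp_all add: kleisli_K_def)
  \<comment> \<open>The equation is proved field by field, also off \<open>A\<close>, because
    \<open>functor_eqI\<close> would first require functoriality of the left side.\<close>
  have src: "kleisli_K B \<T> \<odot> (kleisli_J B \<T> \<odot> kleisli_K B \<T>) \<odot> R = (MFun \<T> \<odot> p) \<odot> S"
  proof (rule functr.equality)
    show "FOb (kleisli_K B \<T> \<odot> (kleisli_J B \<T> \<odot> kleisli_K B \<T>) \<odot> R) = FOb ((MFun \<T> \<odot> p) \<odot> S)"
    proof
      fix a show "FOb (kleisli_K B \<T> \<odot> (kleisli_J B \<T> \<odot> kleisli_K B \<T>) \<odot> R) a = FOb ((MFun \<T> \<odot> p) \<odot> S) a"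
        by (cases "a \<in> Obj A") (simp_all add: K_FSrc KR_FOb K_J, simp add: fcomp_def)
    qed
    show "FAr (kleisli_K B \<T> \<odot> (kleisli_J B \<T> \<odot> kleisli_K B \<T>) \<odot> R) = FAr ((MFun \<T> \<odot> p) \<odot> S)"
    proof
      fix f show "FAr (kleisli_K B \<T> \<odot> (kleisli_J B \<T> \<odot> kleisli_K B \<T>) \<odot> R) f = FAr ((MFun \<T> \<odot> p) \<odot> S) f"
        by (cases "f \<in> Arr A") (simp_all add: K_FSrc KR_FAr K_J_FAr, simp add: fcomp_def)
    qed
  qed (simp_all add: K_FSrc)
  show "nat_trans A B ((MFun \<T> \<odot> p) \<odot> S) (p \<odot> S) \<xi>"
  proof (rule nat_transI)
    show "is_functor A B ((MFun \<T> \<odot> p) \<odot> S)" "is_functor A B (p \<odot> S)"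
      by (intro is_functor_fcomp; unfold_locales)+
    show "NSrc \<xi> = (MFun \<T> \<odot> p) \<odot> S"
      by (simp add: \<xi>_def src kleisli_counit_def)
    show "NTgt \<xi> = p \<odot> S"
      by (simp add: \<xi>_def kleisli_counit_def fcomp_Id_functor [OF R.is_functor_axioms] KR)
    show "NMap \<xi> \<in> extensional (Obj A)"
      by (simp add: \<xi>_def whisker_left_def)
  next
    fix a assume "a \<in> Obj A"
    then show "NMap \<xi> a \<in> hom B (FOb ((MFun \<T> \<odot> p) \<odot> S) a) (FOb (p \<odot> S) a)"
      by (simp add: \<xi>_NMap hom_def R_Obj pS)
  next
    fix f assume f [simp]: "f \<in> Arr A"
    note [simp] = R_FAr [OF f] R_Obj
    \<comment> \<open>Write \<open>r\<close> for the arrow of \<open>B\<close> underlying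
      \<open>FAr R f\<close>. As \<open>p S f\<close> is the multiplication after
      \<open>T r\<close>, naturality of \<open>\<xi>\<close> follows from associativity of
      \<open>\<T>\<close> and then naturality of the multiplication at \<open>r\<close>.\<close>
    have "NMap (MMult \<T>) (FOb R (Cod A f)) \<cdot>\<^bsub>B\<^esub> FAr (MFun \<T>) (FAr p (FAr S f))
        = NMap (MMult \<T>) (FOb R (Cod A f)) \<cdot>\<^bsub>B\<^esub>
          (NMap (MMult \<T>) (FOb (MFun \<T>) (FOb R (Cod A f))) \<cdot>\<^bsub>B\<^esub> FAr (MFun \<T>) (FAr (MFun \<T>) (fst (FAr R f))))"
      by (simp add: pS_FAr T.MFun.src.Comp_extend [OF T.assoc_NMap])
    also have "\<dots> = FAr p (FAr S f) \<cdot>\<^bsub>B\<^esub> NMap (MMult \<T>) (FOb R (Dom A f))"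
      using T.MMult.naturality_Arr [of "fst (FAr R f)" "FOb R (Dom A f)" "FOb (MFun \<T>) (FOb R (Cod A f))"]
      by (simp add: pS_FAr)
    finally show "NMap \<xi> (Cod A f) \<cdot>\<^bsub>B\<^esub> FAr ((MFun \<T> \<odot> p) \<odot> S) f
        = FAr (p \<odot> S) f \<cdot>\<^bsub>B\<^esub> NMap \<xi> (Dom A f)"
      by (simp add: \<xi>_NMap)
  qed
qed

text \<open>A codensity lifting depends on the chosen cartesian \<open>\<sigma>\<close>, so the
  claim is made for every choice; the first conjunct shows that there is one.\<close>

theorem theorem3p5:
  fixes A :: "('oa, 'aa) category" and E :: "('oe, 'ae) category" and B :: "('ob, 'ab) category"
    and p :: "('oe, 'ae, 'ob, 'ab) functr"
    and \<T> :: "('ob, 'ab) monad"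
    and R :: "('oa, 'aa, 'ob, 'ab \<times> 'ob) functr"
    and S :: "('oa, 'aa, 'oe, 'ae) functr"
    and G :: "('oe, 'ae, 'oe, 'ae) functr"
    and c :: "('oa, 'aa, 'oe, 'ae) nattrans"
  assumes "fibration E B p"
    and "is_monad B \<T>"
    and "lifting_parameter A E B p \<T> R S"
    and "right_kan_extension A E E S S G c"
    and "preserves_right_kan_extension A E B p S S G c"
  shows "(\<exists>\<sigma>. cartesian_lifting (postcomposition E p)
                (codensity_comparison E B p \<T> R S G c) G \<sigma>) \<and>
         (\<forall>\<sigma>. cartesian_lifting (postcomposition E p)
                (codensity_comparison E B p \<T> R S G c) G \<sigma> \<longrightarrow>
            is_monad E (codensity_lifting E p \<T> S G c \<sigma>) \<and>
            is_lifting E p \<T> (codensity_lifting E p \<T> S G c \<sigma>))"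
proof -
  have p: "is_functor E B p" using assms(1) by (simp add: fibration_def)
  interpret T: is_monad B \<T> by fact
  note \<xi> = lifting_parameter_algebra [OF assms(2) p assms(3)]
  \<comment> \<open>Since \<open>\<xi>\<close> is the multiplication at \<open>R a\<close>, its two
    algebra laws are the left unit law and associativity of \<open>\<T>\<close> at
    \<open>R a\<close>.\<close>
  interpret codensity_algebra A E S G c B p \<T> "kleisli_K B \<T> \<rhd> kleisli_counit B \<T> \<lhd> R"
    using assms p \<xi>
    by (intro codensity_algebra.intro codensity.intro codensity_algebra_axioms.intro)
      (simp_all add: preserves_right_kan_extension_def T.left_unit_NMap T.assoc_NMap)
  have \<alpha>_eq: "codensity_comparison E B p \<T> R S G c = \<alpha>"
    by (simp add: codensity_comparison_def \<alpha>_def)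
  have "is_monad E (codensity_lifting E p \<T> S G c \<sigma>) \<and> is_lifting E p \<T> (codensity_lifting E p \<T> S G c \<sigma>)"
    if "cartesian_lifting (postcomposition E p) \<alpha> G \<sigma>" for \<sigma>
  proof -
    interpret codensity_algebra_lifting A E S G c B p \<T> "kleisli_K B \<T> \<rhd> kleisli_counit B \<T> \<lhd> R" \<sigma>
      using that by unfold_locales
    show ?thesis by (simp add: is_monad_codensity_lifting is_lifting_codensity_lifting)
  qed
  moreover have "\<exists>\<sigma>. cartesian_lifting (postcomposition E p) \<alpha> G \<sigma>"
    by (rule cartesian_lifting_postcomposition_ex [OF assms(1) G.is_functor_axioms \<alpha>.nat_trans_axioms])
  ultimately show ?thesis unfolding \<alpha>_eq by blast
qed

end
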